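(* Let $G$ be a finite solvable group. If $P^*(G)$ is claw-free, then $\pi(G)\leq 4$.
   Context: For a group $G$, the power graph $P(G)$ is the simple undirected graph whose vertices are the elements of $G$, two distinct vertices $u,v$ being adjacent if and only if one of them is a power of the other (equivalently, one of $\langle u\rangle,\langle v\rangle$ is contained in the other). The reduced power graph $P^*(G)$ is the subgraph of $P(G)$ induced by the non-identity elements. A graph is claw-free if it has no induced subgraph isomorphic to the complete bipartite graph $K_{1,3}$. $\pi(G)$ denotes the number of distinct prime divisors of $|G|$. *)

theory Defs
  imports
    "HOL-Algebra.Solvable_Groups"
    "HOL-Computational_Algebra.Primes"
    "Graph_Theory.Graph_Theory"
begin

text \<open>
  Simple undirected graphs are loop-free symmetric digraphs without parallel arcs, as in the
  locale \<^locale>\<open>graph\<close>. Exponents are integers, so that in every group (finite or not) being a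
  power of \<open>u\<close> means lying in the cyclic subgroup generated by \<open>u\<close>; in a finite group natural
  exponents give the same graph.
\<close>

definition power_graph :: "('a, 'b) monoid_scheme \<Rightarrow> ('a, 'a \<times> 'a) pre_digraph" where
  "power_graph G = with_proj
     \<lparr> pverts = carrier G,
       parcs = {(u, v). u \<in> carrier G \<and> v \<in> carrier G \<and> u \<noteq> v \<and>
                  ((\<exists>k::int. v = u [^]\<^bsub>G\<^esub> k) \<or> (\<exists>k::int. u = v [^]\<^bsub>G\<^esub> k))} \<rparr>"

definition reduced_power_graph :: "('a, 'b) monoid_scheme \<Rightarrow> ('a, 'a \<times> 'a) pre_digraph" where
  "reduced_power_graph G = power_graph G \<restriction> (carrier G - {\<one>\<^bsub>G\<^esub>})"

definition claw_free :: "('a, 'b) pre_digraph \<Rightarrow> bool" where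
  "claw_free \<Gamma> \<longleftrightarrow> \<not> (\<exists>H. induced_subgraph H \<Gamma> \<and> complete_bipartite_digraph 1 3 H)"

definition num_prime_divisors :: "('a, 'b) monoid_scheme \<Rightarrow> nat" where
  "num_prime_divisors G = card (prime_factors (order G))"

lemma graph_reduced_power_graph:
  assumes "finite (carrier G)"
  shows "graph (reduced_power_graph G)"
proof -
  let ?R = "reduced_power_graph G"
  have arcs: "arcs ?R \<subseteq> carrier G \<times> carrier G"
    by (auto simp: reduced_power_graph_def power_graph_def induce_subgraph_def)
  show ?thesis
  proof
    show "finite (arcs ?R)"
      using arcs assms by (meson finite_SigmaI finite_subset)
  qed (use assms in \<open>auto simp: reduced_power_graph_def power_graph_def induce_subgraph_def
         with_proj_def arc_to_ends_def symmetric_conv\<close>)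
qed

end

theory Submission
  imports
    Defs
    "HOL-Algebra.Multiplicative_Group"
    "HOL-Algebra.Sylow"
    "HOL-Algebra.Group_Action"
    "HOL-Algebra.Left_Coset"
begin

text \<open>
  Call two subgroups of prime order neighbours if their orders differ and they commute
  elementwise. Claw-freeness implies that a subgroup of prime order has at most one neighbour
  (\<open>unique_prime_neighbour\<close>). Indeed, three neighbours of \<open>\<langle>x\<rangle>\<close> give a claw at \<open>x\<close> with leaves
  \<open>x u\<close>, where \<open>u\<close> generates a neighbour. If there are just two, they normalise each other, hence
  commute; then either they span a third neighbour, or some element has an order with three prime
  divisors \<open>p\<close>, \<open>q\<close>, \<open>r\<close>, and that element together with its powers of orders \<open>p\<close>, \<open>q\<close>, \<open>r\<close> is a
  claw (\<open>no_three_primes_dvd_ord\<close>). Both facts are used throughout.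

  Suppose that a solvable claw-free group \<open>G\<close> has five prime divisors. There is an elementary
  abelian normal \<open>p\<close>-subgroup \<open>N \<noteq> 1\<close>. Let \<open>P\<close> be a largest normal \<open>p\<close>-subgroup and \<open>L / P\<close> an
  elementary abelian normal subgroup of \<open>G / P\<close>; it is a \<open>b\<close>-group for a prime \<open>b \<noteq> p\<close>, and it is
  isomorphic to a Sylow \<open>b\<close>-subgroup \<open>B\<close> of \<open>L\<close>. By the Frattini argument the normaliser of \<open>B\<close>
  contains elements of order \<open>r\<close> for every prime divisor \<open>r\<close> of the order of \<open>G\<close> other than \<open>p\<close> and
  \<open>b\<close>. There are at least three such \<open>r\<close>, and this contradicts \<open>no_three_normalizing_primes\<close>, whose
  proof counts the set of subgroups of order \<open>p\<close> in \<open>N\<close> that have a neighbour in \<open>B\<close>, here called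
  lines.

  If there are no lines, all nontrivial elements of \<open>B\<close> act on \<open>N\<close> without fixed points, so \<open>B\<close> is
  cyclic. By uniqueness of neighbours, elements of the normaliser centralise \<open>B\<close> for at most one of
  the three primes. For the other two primes \<open>q\<close> and \<open>r\<close> the action on \<open>B\<close> yields commuting elements
  \<open>u\<close>, \<open>v\<close> of orders \<open>q\<close>, \<open>r\<close>, where \<open>u\<close> acts nontrivially on \<open>B\<close>. Then \<open>u\<close> fixes some nontrivial
  element of \<open>N\<close>, and \<open>\<langle>u\<rangle>\<close> has a neighbour of order \<open>p\<close> besides \<open>\<langle>v\<rangle>\<close>.

  If there is just one line, the normaliser of \<open>B\<close> acts on it through an abelian group, and the
  elements of the three prime orders act nontrivially because the neighbour of the line has order
  \<open>b\<close>. The product of three such elements then has an order divisible by three primes.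

  If there are \<open>k \<ge> 2\<close> lines, an element \<open>y\<close> of the normaliser of prime order \<open>r\<close> leaves at most one
  of them invariant, and the other lines form a single \<open>\<langle>y\<rangle>\<close>-orbit, since the products over two
  orbits would be independent fixed points of \<open>y\<close>, giving two neighbours of \<open>\<langle>y\<rangle>\<close>. Hence
  \<open>r \<in> {k, k - 1}\<close>, which is impossible for three different primes.

  The facts about fixed points and about independence rest on trace maps of the action on \<open>N\<close>
  (\<open>fixed_point_free_partition\<close> and \<open>trace_other_line\<close>).
\<close>

section \<open>Conjugation and cyclic subgroups of prime order\<close>

locale finite_group = group +
  assumes fin: "finite (carrier G)"

context group begin

abbreviation cyc :: "'a \<Rightarrow> 'a set" where "cyc v \<equiv> generate G {v}"

definition conjby :: "'a \<Rightarrow> 'a \<Rightarrow> 'a" where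
  "conjby g x = g \<otimes> x \<otimes> inv g"

lemma conjby_closed [simp, intro]: "g \<in> carrier G \<Longrightarrow> x \<in> carrier G \<Longrightarrow> conjby g x \<in> carrier G"
  by (simp add: conjby_def)

lemma conjby_one [simp]: "g \<in> carrier G \<Longrightarrow> conjby g \<one> = \<one>"
  by (simp add: conjby_def)

lemma one_conjby [simp]: "x \<in> carrier G \<Longrightarrow> conjby \<one> x = x"
  by (simp add: conjby_def)

lemma conjby_mult:
  assumes "g \<in> carrier G" "x \<in> carrier G" "y \<in> carrier G"
  shows "conjby g (x \<otimes> y) = conjby g x \<otimes> conjby g y"
  using assms unfolding conjby_def by (simp add: m_assoc inv_solve_left)

lemma conjby_comp:
  assumes "g \<in> carrier G" "h \<in> carrier G" "x \<in> carrier G"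
  shows "conjby (g \<otimes> h) x = conjby g (conjby h x)"
  using assms unfolding conjby_def by (simp add: m_assoc inv_mult_group)

lemma conjby_inv_cancel [simp]:
  assumes "g \<in> carrier G" "x \<in> carrier G"
  shows "conjby (inv g) (conjby g x) = x" "conjby g (conjby (inv g) x) = x"
  using assms by (simp_all flip: conjby_comp)

lemma conjby_pow:
  assumes "g \<in> carrier G" "x \<in> carrier G"
  shows "conjby g (x [^] (n::nat)) = conjby g x [^] n"
  using assms by (induction n) (simp_all add: conjby_mult)

lemma conjby_inv:
  assumes "g \<in> carrier G" "x \<in> carrier G"
  shows "conjby g (inv x) = inv (conjby g x)"
  using assms by (simp add: conjby_def inv_mult_group m_assoc)

lemma conjby_eq_one_iff [simp]:
  assumes "g \<in> carrier G" "x \<in> carrier G"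
  shows "conjby g x = \<one> \<longleftrightarrow> x = \<one>"
  using assms by (metis conjby_inv_cancel(1) conjby_one inv_closed)

lemma conjby_eq_iff:
  assumes "g \<in> carrier G" "x \<in> carrier G" "y \<in> carrier G"
  shows "conjby g x = conjby g y \<longleftrightarrow> x = y"
  using assms by (metis conjby_inv_cancel(1))

lemma ord_conjby [simp]:
  assumes "g \<in> carrier G" "x \<in> carrier G"
  shows "ord (conjby g x) = ord x"
  using assms by (subst ord_unique) (simp_all add: pow_eq_id flip: conjby_pow)

lemma conjby_eq_self_iff:
  assumes "g \<in> carrier G" "x \<in> carrier G"
  shows "conjby g x = x \<longleftrightarrow> g \<otimes> x = x \<otimes> g"
  using assms unfolding conjby_def by (metis inv_solve_right m_closed)

lemma conjby_comm:
  assumes "g \<in> carrier G" "x \<in> carrier G" "y \<in> carrier G"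
  shows "conjby g x \<otimes> conjby g y = conjby g y \<otimes> conjby g x \<longleftrightarrow> x \<otimes> y = y \<otimes> x"
  using assms by (metis conjby_eq_iff conjby_mult m_closed)

lemma conjby_fixes_pow:
  assumes "g \<in> carrier G" "x \<in> carrier G" "conjby g x = x"
  shows "conjby (g [^] (n::nat)) x = x"
  using assms by (induction n) (simp_all add: conjby_comp)

definition elementary_abelian :: "nat \<Rightarrow> 'a set \<Rightarrow> bool" where
  "elementary_abelian q A \<longleftrightarrow> prime q \<and> subgroup A G \<and>
     (\<forall>x\<in>A. \<forall>y\<in>A. x \<otimes> y = y \<otimes> x) \<and> (\<forall>x\<in>A. x [^] q = \<one>)"

lemma elementary_abelianD:
  assumes "elementary_abelian q A"
  shows "prime q" "subgroup A G" "x \<in> A \<Longrightarrow> y \<in> A \<Longrightarrow> x \<otimes> y = y \<otimes> x" "x \<in> A \<Longrightarrow> x [^] q = \<one>"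
  using assms unfolding elementary_abelian_def by simp_all

lemma cyc_self: "v \<in> cyc v" by (simp add: generate.incl)

lemma cyc_subgroup: "v \<in> carrier G \<Longrightarrow> subgroup (cyc v) G"
  by (simp add: generate_is_subgroup)

lemma cyc_sub: "v \<in> carrier G \<Longrightarrow> a \<in> cyc v \<Longrightarrow> cyc a \<subseteq> cyc v"
  by (meson cyc_subgroup empty_subsetI generate_subgroup_incl insert_subset)

lemma cyc_carrier: "v \<in> carrier G \<Longrightarrow> a \<in> cyc v \<Longrightarrow> a \<in> carrier G"
  by (meson cyc_subgroup subgroup.mem_carrier)

end

context finite_group begin

lemma ord_pos: "v \<in> carrier G \<Longrightarrow> ord v > 0"
  using ord_ge_1[OF fin] by fastforce

lemma mem_cyc_iff: "v \<in> carrier G \<Longrightarrow> a \<in> cyc v \<longleftrightarrow> (\<exists>k::nat. a = v [^] k)"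
  by (simp add: generate_pow_on_finite_carrier[OF fin])

lemma ord_mem_cyc: "v \<in> carrier G \<Longrightarrow> a \<in> cyc v \<Longrightarrow> ord a dvd ord v"
  using mem_cyc_iff by (metis mult.commute nat_pow_closed nat_pow_one nat_pow_pow pow_eq_id pow_ord_eq_1)

text \<open>
  Subgroups of prime order have no proper nontrivial subgroups. Statements about such subgroups are
  phrased through generators, and this is the way to change the generator.
\<close>

lemma cyc_eqI_prime:
  assumes v: "v \<in> carrier G" "prime (ord v)" and a: "a \<in> cyc v" "a \<noteq> \<one>"
  shows "cyc a = cyc v"
proof -
  have ac: "a \<in> carrier G" using a(1) v(1) cyc_carrier by blast
  have "ord a dvd ord v" using ord_mem_cyc a(1) v(1) by blast
  moreover have "ord a \<noteq> 1" using a ac ord_eq_1 by blast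
  ultimately have "ord a = ord v" using v(2) prime_nat_iff by metis
  then have "card (cyc a) = card (cyc v)" using generate_pow_card ac v(1) by metis
  moreover have "cyc a \<subseteq> cyc v" by (simp add: a(1) cyc_sub v(1))
  moreover have "finite (cyc v)" using v(1) fin cyc_subgroup finite_subset subgroup.subset by metis
  ultimately show ?thesis by (simp add: card_subset_eq)
qed

lemma cyc_eq_ord: "a \<in> carrier G \<Longrightarrow> b \<in> carrier G \<Longrightarrow> cyc a = cyc b \<Longrightarrow> ord a = ord b"
  by (metis generate_pow_card)

lemma comm_cyc:
  assumes "g \<in> carrier G" "v \<in> carrier G" "g \<otimes> v = v \<otimes> g" "a \<in> cyc v"
  shows "g \<otimes> a = a \<otimes> g"
proof -
  obtain k :: nat where "a = v [^] k" using assms mem_cyc_iff by blast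
  then show ?thesis using assms 
by (metis conjby_eq_self_iff conjby_pow nat_pow_closed)
qed

lemma cyc_conjby:
  assumes "g \<in> carrier G" "v \<in> carrier G"
  shows "cyc (conjby g v) = conjby g ` cyc v"
proof -
  have "conjby g ` cyc v = {conjby g (v [^] k) |k::nat. True}"
    using mem_cyc_iff[OF assms(2)] by auto
  then show ?thesis
    using mem_cyc_iff[of "conjby g v"] assms by (auto simp: conjby_pow)
qed

text \<open>
  Cauchy's theorem, as the case of exponent one of the existence of subgroups of prime power order.
\<close>

lemma cauchy:
  assumes "prime q" "q dvd order G"
  obtains x where "x \<in> carrier G" "ord x = q"
proof -
  obtain m where "order G = q ^ 1 * m" using assms(2) by auto
  then obtain H where H: "subgroup H G" "card H = q ^ 1"
    using sylow_thm[OF assms(1) is_group _ fin] by blast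
  have "H \<noteq> {\<one>}" using H(2) assms(1) by auto
  then obtain x where x: "x \<in> H" "x \<noteq> \<one>" using H(1) subgroup.one_closed by blast
  have xc: "x \<in> carrier G" using subgroup.mem_carrier[OF H(1) x(1)] .
  interpret H: group "G\<lparr>carrier := H\<rparr>" by (rule subgroup_imp_group[OF H(1)])
  have "x [^]\<^bsub>G\<lparr>carrier := H\<rparr>\<^esub> order (G\<lparr>carrier := H\<rparr>) = \<one>"
    using H.pow_order_eq_1[of x] x by simp
  then have "x [^] q = \<one>" using H by (simp add: order_def nat_pow_consistent[symmetric])
  then have "ord x dvd q" by (simp add: pow_eq_id xc)
  moreover have "ord x \<noteq> 1" using x xc ord_eq_1 by blast
  ultimately have "ord x = q" using assms(1) prime_nat_iff by metis
  with that xc show ?thesis by metis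
qed

end

section \<open>Claws and commuting elements of prime order\<close>

locale claw_free_group = finite_group +
  assumes claw_free: "claw_free (reduced_power_graph G)"

context claw_free_group begin

text \<open>
  The subgraph induced on \<open>c\<close> and the three elements of \<open>V\<close> is a claw, because membership in \<open>cyc\<close>
  is the power relation that defines adjacency.
\<close>

lemma no_claw:
  assumes c: "c \<in> carrier G - {\<one>}" and V: "V \<subseteq> carrier G - {\<one>}" and card: "card V = 3"
    and adj: "\<And>a. a \<in> V \<Longrightarrow> a \<noteq> c \<and> (c \<in> cyc a \<or> a \<in> cyc c)"
    and nadj: "\<And>a b. a \<in> V \<Longrightarrow> b \<in> V \<Longrightarrow> a \<noteq> b \<Longrightarrow> a \<notin> cyc b"
  shows False
proof -
  let ?R = "reduced_power_graph G" and ?W = "insert c V"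
  interpret R: graph ?R by (rule graph_reduced_power_graph[OF fin])
  have cV: "c \<notin> V" using adj by auto
  have W: "u \<in> carrier G" "u \<noteq> \<one>" if "u \<in> ?W" for u using that c V by auto
  let ?H = "?R \<restriction> ?W"
  have "?W \<subseteq> verts ?R" using c V by (simp add: reduced_power_graph_def)
  then have ind: "induced_subgraph ?H ?R" by (rule R.induced_induce)
  have "(u, v) \<in> arcs_ends ?H \<longleftrightarrow> u \<in> ?W \<and> v \<in> ?W \<and> u \<noteq> v \<and> (v \<in> cyc u \<or> u \<in> cyc v)" for u v
  proof -
    have "arcs_ends ?H = arcs ?H"
      by (simp add: arcs_ends_def arc_to_ends_def reduced_power_graph_def power_graph_def
        induce_subgraph_def with_proj_def)
    moreover have "(u, v) \<in> arcs ?H \<longleftrightarrow>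
       u \<in> ?W \<and> v \<in> ?W \<and> u \<noteq> v \<and> ((\<exists>k::int. v = u [^] k) \<or> (\<exists>k::int. u = v [^] k))"
      using W[of u] W[of v] unfolding reduced_power_graph_def power_graph_def induce_subgraph_def with_proj_def
      by (simp del: insert_iff add: singleton_iff) metis
    moreover have "(\<exists>k::int. y = x [^] k) \<longleftrightarrow> y \<in> cyc x" if "x \<in> ?W" for x y
      using generate_pow[OF W(1)[OF that]] by auto
    ultimately show ?thesis by metis
  qed
  then have ends: "arcs_ends ?H = {c} \<times> V \<union> V \<times> {c}"
    using adj nadj cV by (simp only: set_eq_iff split_paired_All) (auto; metis)
  have H: "graph ?H"
    unfolding graph_def pseudo_graph_def
    using R.digraphI_induced[OF ind] R.induced_graph_imp_graph[OF ind]
    unfolding digraph_def by simp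
  have "complete_bipartite_digraph 1 3 ?H"
    unfolding complete_bipartite_digraph_def
    using H card ends cV by (intro conjI exI[of _ "{c}"] exI[of _ V]) simp_all
  with ind have "\<exists>H. induced_subgraph H ?R \<and> complete_bipartite_digraph 1 3 H"
    by (intro exI[of _ ?H] conjI)
  then show False using claw_free unfolding claw_free_def by (rule notE[rotated])
qed

text \<open>
  The powers of \<open>g\<close> of three prime orders are the leaves of a claw at \<open>g\<close>: their orders do not
  divide each other.
\<close>

lemma no_three_primes_dvd_ord:
  assumes g: "g \<in> carrier G" and Q: "card Q = 3" "\<And>q. q \<in> Q \<Longrightarrow> prime q \<and> q dvd ord g"
  shows False
proof -
  let ?a = "\<lambda>q. g [^] (ord g div q)"
  have o: "ord (?a q) = q" if "q \<in> Q" for q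
  proof -
    have q: "q dvd ord g" "q > 0" using Q(2)[OF that] prime_gt_0_nat by auto
    moreover have "ord g div q > 0" 
      using q ord_pos[OF g] by (metis div_greater_zero_iff dvd_imp_le)
    ultimately show ?thesis
      using ord_pow[OF g, of "ord g div q"] ord_pos[OF g] by (auto elim!: dvdE)
  qed
  have inj: "inj_on ?a Q" by (rule inj_on_inverseI[of _ ord]) (rule o)
  have fQ: "finite Q" using Q(1) card.infinite by fastforce
  show False
  proof (rule no_claw[of g "?a ` Q"])
    have "ord g \<noteq> 1"
    proof
      assume "ord g = 1"
      moreover obtain q where "q \<in> Q" using Q(1) by fastforce
      ultimately show False using Q(2) by fastforce
    qed
    then show "g \<in> carrier G - {\<one>}" using g by auto
    show "?a ` Q \<subseteq> carrier G - {\<one>}"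
    proof
      fix x assume "x \<in> ?a ` Q"
      then obtain q where q: "q \<in> Q" "x = ?a q" by auto
      have "ord x \<noteq> 1" using o[OF q(1)] Q(2)[OF q(1)] q(2) by auto
      then show "x \<in> carrier G - {\<one>}" using q g by auto
    qed
    show "card (?a ` Q) = 3" using inj Q(1) by (simp add: card_image)
    show "x \<noteq> g \<and> (g \<in> cyc x \<or> x \<in> cyc g)" if x: "x \<in> ?a ` Q" for x
    proof -
      obtain q where q: "q \<in> Q" "x = ?a q" using x by auto
      have "Q \<noteq> {q}" using Q(1) by auto
      then obtain q' where q': "q' \<in> Q" "q' \<noteq> q" using q(1) by auto
      then have "\<not> q' dvd q" using Q(2)[OF q'(1)] Q(2)[OF q(1)] primes_dvd_imp_eq by blast
      then have "ord g \<noteq> q" using Q(2)[OF q'(1)] by auto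
      then have "x \<noteq> g" using o[OF q(1)] q(2) by auto
      moreover have "x \<in> cyc g" using q mem_cyc_iff[OF g] by auto
      ultimately show ?thesis by simp
    qed
    show "x \<notin> cyc y" if xy: "x \<in> ?a ` Q" "y \<in> ?a ` Q" "x \<noteq> y" for x y
    proof
      assume "x \<in> cyc y"
      moreover obtain q q' where q: "q \<in> Q" "x = ?a q" "q' \<in> Q" "y = ?a q'"
        using xy by auto
      ultimately have "q dvd q'" using ord_mem_cyc[of y x] o g by simp
      then have "q = q'" using q Q(2) primes_dvd_imp_eq by blast
      then show False using q xy by simp
    qed
  qed
qed

text \<open>
  The leaves of the claw are the products \<open>x \<otimes> u\<close>. Each has \<open>x\<close> as a power, since the orders of \<open>x\<close>
  and \<open>u\<close> are coprime, and raising to the power \<open>ord x\<close> turns a relation between two leaves into one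
  between the corresponding elements of \<open>U\<close>.
\<close>

lemma no_three_prime_neighbours:
  assumes x: "x \<in> carrier G" "prime (ord x)" and U: "U \<subseteq> carrier G" "card U = 3"
    and pr: "\<And>u. u \<in> U \<Longrightarrow> prime (ord u) \<and> ord u \<noteq> ord x \<and> x \<otimes> u = u \<otimes> x"
    and dist: "\<And>u v. u \<in> U \<Longrightarrow> v \<in> U \<Longrightarrow> u \<noteq> v \<Longrightarrow> u \<notin> cyc v"
  shows False
proof -
  have xu: "(x \<otimes> u) [^] (n::nat) = x [^] n \<otimes> u [^] n" if "u \<in> U" for u n
    using pr[OF that] x(1) U(1) that by (intro pow_mult_distrib) auto
  have cop: "coprime (ord x) (ord u)" if "u \<in> U" for u
    using primes_coprime x(2) pr[OF that] by metis
  have root: "u \<in> cyc (u [^] ord x)" if "u \<in> U" for u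
  proof -
    have uc: "u \<in> carrier G" using that U by auto
    have "u [^] ord x \<noteq> \<one>"
    proof
      assume "u [^] ord x = \<one>"
      then have "ord u dvd ord x" using pow_eq_id[OF uc] by simp
      then show False using cop[OF that] pr[OF that] by (metis coprime_absorb_right not_prime_unit)
    qed
    moreover have "u [^] ord x \<in> cyc u" using mem_cyc_iff[OF uc] by auto
    ultimately have "cyc (u [^] ord x) = cyc u" using cyc_eqI_prime[OF uc] pr[OF that] by blast
    then show ?thesis using cyc_self by simp
  qed
  show False
  proof (rule no_claw[of x "(\<otimes>) x ` U"])
    show "x \<in> carrier G - {\<one>}" using x by auto
    show "card ((\<otimes>) x ` U) = 3" using U x by (subst card_image) (auto simp: inj_on_def subset_iff)
    show "(\<otimes>) x ` U \<subseteq> carrier G - {\<one>}"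
    proof
      fix w assume "w \<in> (\<otimes>) x ` U"
      then obtain u where u: "u \<in> U" "w = x \<otimes> u" by auto
      have uc: "u \<in> carrier G" using u U by auto
      have "w \<noteq> \<one>"
      proof
        assume "w = \<one>"
        then have "u = inv x" using u uc x by (metis inv_equality inv_inv inv_closed)
        then have "ord u = ord x" using x by simp
        then show False using pr[OF u(1)] by simp
      qed
      then show "w \<in> carrier G - {\<one>}" using u uc x by auto
    qed
    show "w \<noteq> x \<and> (x \<in> cyc w \<or> w \<in> cyc x)" if w: "w \<in> (\<otimes>) x ` U" for w
    proof -
      obtain u where u: "u \<in> U" "w = x \<otimes> u" using w by auto
      have uc: "u \<in> carrier G" using u U by auto
      have "u \<noteq> \<one>" using pr[OF u(1)] by auto
      then have "w \<noteq> x" using u(2) uc x(1) by simp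
      have "x [^] ord u \<noteq> \<one>"
      proof
        assume "x [^] ord u = \<one>"
        then have "ord x dvd ord u" using pow_eq_id[OF x(1)] by simp
        then show False using cop[OF u(1)] x(2) by (metis coprime_absorb_left not_prime_unit)
      qed
      moreover have "x [^] ord u \<in> cyc x" using mem_cyc_iff[OF x(1)] by auto
      ultimately have "cyc (x [^] ord u) = cyc x" using cyc_eqI_prime[OF x] by blast
      moreover have "x [^] ord u = w [^] ord u" using xu[OF u(1), of "ord u"] uc u(2) x by simp
      moreover have "w [^] ord u \<in> cyc w" using mem_cyc_iff[of w] u uc x by auto
      ultimately have "x \<in> cyc w" using cyc_self[of x] cyc_sub[of w "w [^] ord u"] u uc x by auto
      then show ?thesis using \<open>w \<noteq> x\<close> by simp
    qed
    show "w \<notin> cyc w'" if w: "w \<in> (\<otimes>) x ` U" "w' \<in> (\<otimes>) x ` U" "w \<noteq> w'" for w w'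
    proof
      assume m: "w \<in> cyc w'"
      obtain u v where u: "u \<in> U" "w = x \<otimes> u" "v \<in> U" "w' = x \<otimes> v" using w by auto
      have c: "u \<in> carrier G" "v \<in> carrier G" using u U by auto
      obtain k :: nat where "x \<otimes> u = (x \<otimes> v) [^] k" using m mem_cyc_iff[of w'] u c x by auto
      then have "(x \<otimes> u) [^] ord x = ((x \<otimes> v) [^] ord x) [^] k"
        using c x by (simp add: nat_pow_pow mult.commute)
      then have "u [^] ord x = (v [^] ord x) [^] k"
        using xu[OF u(1), of "ord x"] xu[OF u(3), of "ord x"] c x by simp
      then have "u [^] ord x \<in> cyc v" using mem_cyc_iff[OF c(2)] c by (auto simp: nat_pow_pow)
      then have "u \<in> cyc v" using cyc_sub[OF c(2)] root[OF u(1)] by blast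
      then show False using dist[OF u(1,3)] u w(3) by auto
    qed
  qed
qed

text \<open>
  This is all that the proof keeps of claw-freeness besides \<open>no_three_primes_dvd_ord\<close>. If
  \<open>\<langle>u\<rangle>\<close> and \<open>\<langle>v\<rangle>\<close> were different, they would be the only two neighbours of \<open>\<langle>x\<rangle>\<close>, so each of
  \<open>u\<close> and \<open>v\<close> normalises the subgroup generated by the other, which makes them commute. If the
  orders agree, \<open>u \<otimes> v\<close> generates a third neighbour; if not, \<open>x \<otimes> u \<otimes> v\<close> has an order with three
  prime divisors.
\<close>

lemma unique_prime_neighbour:
  assumes x: "x \<in> carrier G" "prime (ord x)"
    and u: "u \<in> carrier G" "prime (ord u)" "ord u \<noteq> ord x" "x \<otimes> u = u \<otimes> x"
    and v: "v \<in> carrier G" "prime (ord v)" "ord v \<noteq> ord x" "x \<otimes> v = v \<otimes> x"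
  shows "cyc u = cyc v"
proof (rule ccontr)
  assume ne: "cyc u \<noteq> cyc v"
  \<comment> \<open>\<open>nb w\<close>: the subgroup generated by \<open>w\<close> is a neighbour of \<open>\<langle>x\<rangle>\<close>.\<close>
  define nb where "nb w \<longleftrightarrow> w \<in> carrier G \<and> prime (ord w) \<and> ord w \<noteq> ord x \<and> x \<otimes> w = w \<otimes> x" for w
  have nbu: "nb u" and nbv: "nb v" using u v by (auto simp: nb_def)
  have eqI: "cyc a = cyc b" if "nb a" "nb b" "a \<in> cyc b" for a b
    using that cyc_eqI_prime[of b a] unfolding nb_def by (metis ord_id not_prime_1)
  have two: "cyc w = cyc u \<or> cyc w = cyc v" if w: "nb w" for w
  proof (rule ccontr)
    assume n: "\<not> (cyc w = cyc u \<or> cyc w = cyc v)"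
    have cyc_inj: "cyc a \<noteq> cyc b \<Longrightarrow> a \<noteq> b" for a b by auto
    have d: "w \<noteq> u" "w \<noteq> v" "u \<noteq> v" using n ne cyc_inj by auto
    show False
    proof (rule no_three_prime_neighbours[OF x, of "{u, v, w}"])
      show "card {u, v, w} = 3" using d by simp
      show "{u, v, w} \<subseteq> carrier G" using nbu nbv w by (simp add: nb_def)
      show "prime (ord a) \<and> ord a \<noteq> ord x \<and> x \<otimes> a = a \<otimes> x" if "a \<in> {u, v, w}" for a
        using that nbu nbv w by (auto simp: nb_def)
      show "a \<notin> cyc b" if "a \<in> {u, v, w}" "b \<in> {u, v, w}" "a \<noteq> b" for a b
        using that nbu nbv w eqI[of a b] ne n by auto
    qed
  qed
  have nbconj: "nb (conjby a b)" if "nb a" "nb b" for a b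
  proof -
    have "conjby a x = x" using that x by (simp add: nb_def conjby_eq_self_iff)
    then have "x \<otimes> conjby a b = conjby a b \<otimes> x"
      using conjby_comm[of a x b] that x by (simp add: nb_def)
    then show ?thesis using that by (simp add: nb_def)
  qed
  have "cyc (conjby v u) \<noteq> cyc v"
  proof
    assume "cyc (conjby v u) = cyc v"
    then have "conjby v u \<in> cyc v" using cyc_self by metis
    then have "v \<otimes> conjby v u = conjby v u \<otimes> v" using comm_cyc[of v v] v by simp
    then have "conjby v u = u" using v u conjby_comm[of v v u] conjby_eq_self_iff[of v u] conjby_eq_self_iff[of v v]
      by simp
    then have "u \<in> cyc v" using \<open>conjby v u \<in> cyc v\<close> by simp
    then show False using eqI[OF nbu nbv] ne by simp
  qed
  then have 1: "conjby v u \<in> cyc u" using two[OF nbconj[OF nbv nbu]] cyc_self by metis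
  have "cyc (conjby u v) \<noteq> cyc u"
  proof
    assume "cyc (conjby u v) = cyc u"
    then have "conjby u v \<in> cyc u" using cyc_self by metis
    then have "u \<otimes> conjby u v = conjby u v \<otimes> u" using comm_cyc[of u u] u by simp
    then have "conjby u v = v" using v u conjby_comm[of u u v] conjby_eq_self_iff[of u v] conjby_eq_self_iff[of u u]
      by simp
    then have "v \<in> cyc u" using \<open>conjby u v \<in> cyc u\<close> by simp
    then show False using eqI[OF nbv nbu] ne by simp
  qed
  then have 2: "conjby u v \<in> cyc v" using two[OF nbconj[OF nbu nbv]] cyc_self by metis
  \<comment> \<open>The commutator of \<open>v\<close> and \<open>u\<close> lies in both cyclic subgroups.\<close>
  define d where "d = conjby v u \<otimes> inv u"
  have dc: "d \<in> carrier G" using u v by (simp add: d_def)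
  have d1: "d \<in> cyc u" unfolding d_def
    using 1 subgroup.m_closed[OF cyc_subgroup[OF u(1)]] subgroup.m_inv_closed[OF cyc_subgroup[OF u(1)]] cyc_self by metis
  have "d = v \<otimes> inv (conjby u v)"
    using u v by (simp add: d_def conjby_def inv_mult_group m_assoc)
  then have d2: "d \<in> cyc v"
    using 2 subgroup.m_closed[OF cyc_subgroup[OF v(1)]] subgroup.m_inv_closed[OF cyc_subgroup[OF v(1)]] cyc_self by metis
  have "d = \<one>"
    using cyc_eqI_prime[OF u(1,2) d1] cyc_eqI_prime[OF v(1,2) d2] ne by metis
  then have "conjby v u = u" using u v unfolding d_def by (metis conjby_closed inv_closed inv_equality inv_inv)
  then have vu: "v \<otimes> u = u \<otimes> v" using u v by (simp add: conjby_eq_self_iff)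
  have xuv: "x \<otimes> (u \<otimes> v) = (u \<otimes> v) \<otimes> x"
    using u v x by (metis m_assoc)
  show False
  proof (cases "ord u = ord v")
    case True
    have n1: "u \<otimes> v \<noteq> \<one>"
    proof
      assume "u \<otimes> v = \<one>"
      then have "u = inv v" using u v by (simp add: inv_equality)
      then have "u \<in> cyc v" using subgroup.m_inv_closed[OF cyc_subgroup[OF v(1)] cyc_self] by simp
      then show False using eqI nbu nbv ne by blast
    qed
    have "(u \<otimes> v) [^] ord u = u [^] ord u \<otimes> v [^] ord u"
      using u v vu by (intro pow_mult_distrib) auto
    then have "(u \<otimes> v) [^] ord u = \<one>" using u v True by (metis pow_ord_eq_1 r_one one_closed)
    then have "ord (u \<otimes> v) dvd ord u" using pow_eq_id[of "u \<otimes> v"] u v by simp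
    moreover have "ord (u \<otimes> v) \<noteq> 1" using n1 u v ord_eq_1[of "u \<otimes> v"] by simp
    ultimately have "ord (u \<otimes> v) = ord u" using u(2) prime_nat_iff by metis
    then have "nb (u \<otimes> v)" using u v xuv by (simp add: nb_def)
    then consider "u \<otimes> v \<in> cyc u" | "u \<otimes> v \<in> cyc v" using two[of "u \<otimes> v"] cyc_self by metis
    then show False
    proof cases
      case 1
      then have "inv u \<otimes> (u \<otimes> v) \<in> cyc u"
        using subgroup.m_closed[OF cyc_subgroup[OF u(1)]] subgroup.m_inv_closed[OF cyc_subgroup[OF u(1)] cyc_self] by metis
      then have "v \<in> cyc u" using u v by (simp flip: m_assoc)
      then show False using eqI nbu nbv ne by metis
    next
      case 2
      then have "(u \<otimes> v) \<otimes> inv v \<in> cyc v"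
        using subgroup.m_closed[OF cyc_subgroup[OF v(1)]] subgroup.m_inv_closed[OF cyc_subgroup[OF v(1)] cyc_self] by metis
      then have "u \<in> cyc v" using u v by (simp add: m_assoc)
      then show False using eqI nbu nbv ne by metis
    qed
  next
    case False
    define g where "g = x \<otimes> (u \<otimes> v)"
    have gc: "g \<in> carrier G" using x u v by (simp add: g_def)
    define n where "n = ord g"
    have "g [^] n = \<one>" using gc by (simp add: n_def)
    have gp: "g [^] k = x [^] k \<otimes> (u [^] k \<otimes> v [^] k)" for k :: nat
    proof -
      have "(u \<otimes> v) [^] k = u [^] k \<otimes> v [^] k" using u v vu by (intro pow_mult_distrib) auto
      moreover have "g [^] k = x [^] k \<otimes> (u \<otimes> v) [^] k" 
        unfolding g_def using x u v xuv by (intro pow_mult_distrib) auto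
      ultimately show ?thesis by simp
    qed
    have gn: "g [^] (n * k) = \<one>" for k :: nat
      using gc by (simp add: n_def flip: nat_pow_pow)
    have z: "a [^] (n * b) = \<one>" if "a \<in> carrier G" "ord a dvd b" for a b
      using that pow_eq_id[of a "n * b"] by simp
    have "x [^] (n * (ord u * ord v)) = \<one>"
      using gp[of "n * (ord u * ord v)"] gn[of "ord u * ord v"] z[of u "ord u * ord v"] z[of v "ord u * ord v"] x u v by simp
    then have "ord x dvd n * (ord u * ord v)" using pow_eq_id x(1) by simp
    then have d1: "ord x dvd n" using x(2) u v
      by (metis prime_dvd_mult_iff primes_dvd_imp_eq)
    have "u [^] (n * (ord x * ord v)) = \<one>"
      using gp[of "n * (ord x * ord v)"] gn[of "ord x * ord v"] z[of x "ord x * ord v"] z[of v "ord x * ord v"] x u v by simp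
    then have "ord u dvd n * (ord x * ord v)" using pow_eq_id u(1) by simp
    then have d2: "ord u dvd n" using x(2) u v False
      by (metis prime_dvd_mult_iff primes_dvd_imp_eq)
    have "v [^] (n * (ord x * ord u)) = \<one>"
      using gp[of "n * (ord x * ord u)"] gn[of "ord x * ord u"] z[of x "ord x * ord u"] z[of u "ord x * ord u"] x u v by simp
    then have "ord v dvd n * (ord x * ord u)" using pow_eq_id v(1) by simp
    then have d3: "ord v dvd n" using x(2) u v False
      by (metis prime_dvd_mult_iff primes_dvd_imp_eq)
    show False
      by (rule no_three_primes_dvd_ord[OF gc, of "{ord x, ord u, ord v}"])
        (use d1 d2 d3 x u v False in \<open>auto simp: n_def\<close>)
  qed
qed

end

section \<open>Traces on an elementary abelian normal subgroup\<close>

primrec (in monoid) seqprod :: "(nat \<Rightarrow> 'a) \<Rightarrow> nat \<Rightarrow> 'a" where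
  "seqprod f 0 = \<one>"
| "seqprod f (Suc k) = seqprod f k \<otimes> f k"

text \<open>
  On an abelian normal subgroup, written additively, this is the action of the group ring element
  \<open>1 + y + \<dots> + y ^ (s - 1)\<close>.
\<close>

definition (in group) trace :: "'a \<Rightarrow> nat \<Rightarrow> 'a \<Rightarrow> 'a" where
  "trace y s x = seqprod (\<lambda>j. conjby (y [^] j) x) s"

lemma (in group) conjby_mem_normal: "N \<lhd> G \<Longrightarrow> g \<in> carrier G \<Longrightarrow> x \<in> N \<Longrightarrow> conjby g x \<in> N"
  by (simp add: conjby_def normal.inv_op_closed2)

lemma (in monoid) seqprod_cong: "(\<And>i. i < k \<Longrightarrow> f i = g i) \<Longrightarrow> seqprod f k = seqprod g k"
  by (induction k) auto

lemma (in monoid) seqprod_one: "seqprod (\<lambda>i. \<one>) k = \<one>"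
  by (induction k) auto

lemma (in monoid) seqprod_const: "seqprod (\<lambda>i. x) k = x [^] k"
  by (induction k) auto

locale elementary_abelian_normal = finite_group +
  fixes N and p :: nat
  assumes normal: "N \<lhd> G" and elementary_abelian_N: "elementary_abelian p N"
begin

lemmas p = elementary_abelianD(1)[OF elementary_abelian_N]
  and N_comm = elementary_abelianD(3)[OF elementary_abelian_N]
  and exponent = elementary_abelianD(4)[OF elementary_abelian_N]

lemma N_subgroup: "subgroup N G" by (rule normal_imp_subgroup[OF normal])

lemma N_carrier: "x \<in> N \<Longrightarrow> x \<in> carrier G" by (rule subgroup.mem_carrier[OF N_subgroup])

lemma N_closed: "x \<in> N \<Longrightarrow> y \<in> N \<Longrightarrow> x \<otimes> y \<in> N" by (rule subgroup.m_closed[OF N_subgroup])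

lemma N_one: "\<one> \<in> N" by (rule subgroup.one_closed[OF N_subgroup])

lemma N_pow: "x \<in> N \<Longrightarrow> x [^] (n::nat) \<in> N"
  by (induction n) (simp_all add: N_closed N_one)

lemmas N_conjby = conjby_mem_normal[OF normal]

lemma ord_N: "x \<in> N \<Longrightarrow> x \<noteq> \<one> \<Longrightarrow> ord x = p"
  using exponent[of x] pow_eq_id[of x p] ord_eq_1[of x] N_carrier[of x] p prime_nat_iff by metis

lemma seqprod_mem: "(\<And>i. i < k \<Longrightarrow> f i \<in> N) \<Longrightarrow> seqprod f k \<in> N"
  by (induction k) (simp_all add: N_closed N_one)

lemma mult_interchange:
  "a \<in> N \<Longrightarrow> b \<in> N \<Longrightarrow> c \<in> N \<Longrightarrow> d \<in> N \<Longrightarrow> (a \<otimes> b) \<otimes> (c \<otimes> d) = (a \<otimes> c) \<otimes> (b \<otimes> d)"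
  using N_comm[of b c] N_carrier by (smt (verit) m_assoc m_closed)

lemma seqprod_mult:
  assumes "\<And>i. i < k \<Longrightarrow> f i \<in> N" "\<And>i. i < k \<Longrightarrow> g i \<in> N"
  shows "seqprod (\<lambda>i. f i \<otimes> g i) k = seqprod f k \<otimes> seqprod g k"
  using assms by (induction k) (simp_all add: mult_interchange seqprod_mem)

lemma seqprod_swap:
  assumes "\<And>i j. i < a \<Longrightarrow> j < b \<Longrightarrow> f i j \<in> N"
  shows "seqprod (\<lambda>i. seqprod (f i) b) a = seqprod (\<lambda>j. seqprod (\<lambda>i. f i j) a) b"
  using assms by (induction b) (simp_all add: seqprod_mult seqprod_mem seqprod_one)

lemma conjby_seqprod:
  assumes "g \<in> carrier G" "\<And>i. i < k \<Longrightarrow> f i \<in> N"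
  shows "conjby g (seqprod f k) = seqprod (\<lambda>i. conjby g (f i)) k"
  using assms by (induction k) (simp_all add: conjby_mult N_carrier seqprod_mem)

lemma trace_mem: "y \<in> carrier G \<Longrightarrow> x \<in> N \<Longrightarrow> trace y s x \<in> N"
  by (simp add: trace_def seqprod_mem N_conjby)

lemma trace_mult:
  "y \<in> carrier G \<Longrightarrow> a \<in> N \<Longrightarrow> b \<in> N \<Longrightarrow> trace y s (a \<otimes> b) = trace y s a \<otimes> trace y s b"
  by (simp add: trace_def conjby_mult N_carrier seqprod_mult N_conjby)

lemma trace_one: "y \<in> carrier G \<Longrightarrow> trace y s \<one> = \<one>"
  by (simp add: trace_def seqprod_one)

lemma trace_seqprod:
  assumes "y \<in> carrier G" "\<And>i. i < k \<Longrightarrow> f i \<in> N"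
  shows "trace y s (seqprod f k) = seqprod (\<lambda>i. trace y s (f i)) k"
  using assms by (induction k) (simp_all add: trace_mult trace_one seqprod_mem)

lemma trace_pow: "y \<in> carrier G \<Longrightarrow> x \<in> N \<Longrightarrow> trace y s (x [^] (n::nat)) = trace y s x [^] n"
  by (induction n) (simp_all add: trace_mult trace_one N_pow)

lemma trace_fixed_point:
  assumes "y \<in> carrier G" "x \<in> N" "conjby y x = x"
  shows "trace y s x = x [^] s"
  using assms by (simp add: trace_def conjby_fixes_pow N_carrier seqprod_const)

lemma seqprod_shift:
  assumes "\<And>j. f j \<in> N"
  shows "f 0 \<otimes> seqprod (\<lambda>j. f (Suc j)) k = seqprod f k \<otimes> f k"
proof (induction k)
  case 0
  then show ?case using assms[of 0] N_carrier by simp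
next
  case (Suc k)
  have "f 0 \<otimes> seqprod (\<lambda>j. f (Suc j)) (Suc k) = (f 0 \<otimes> seqprod (\<lambda>j. f (Suc j)) k) \<otimes> f (Suc k)"
    using assms by (simp add: m_assoc N_carrier seqprod_mem)
  then show ?case using Suc by simp
qed

text \<open>
  Conjugation by \<open>y\<close> shifts the factors cyclically.
\<close>

lemma trace_invariant:
  assumes y: "y \<in> carrier G" "y [^] (s::nat) = \<one>" and x: "x \<in> N"
  shows "conjby y (trace y s x) = trace y s x"
proof -
  define f where "f j = conjby (y [^] j) x" for j :: nat
  have f: "f j \<in> N" for j using y x by (simp add: N_conjby f_def)
  have "f 0 \<otimes> seqprod (\<lambda>j. f (Suc j)) s = f 0 \<otimes> seqprod f s"
  proof -
    have "f s = f 0" using y by (simp add: f_def)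
    then show ?thesis using seqprod_shift[of f s] N_comm[of "f 0" "seqprod f s"] f seqprod_mem[of s f] by simp
  qed
  then have "seqprod (\<lambda>j. f (Suc j)) s = seqprod f s"
    using f by (simp add: N_carrier seqprod_mem)
  moreover have "conjby y (f j) = f (Suc j)" for j
    using y x unfolding f_def by (subst nat_pow_Suc2) (simp_all add: conjby_comp N_carrier)
  moreover have "conjby y (trace y s x) = seqprod (\<lambda>j. conjby y (f j)) s"
    unfolding trace_def f_def[symmetric] using y f by (simp add: conjby_seqprod)
  ultimately show ?thesis unfolding trace_def f_def[symmetric] by simp
qed

definition fixed_point_free :: "'a \<Rightarrow> bool" where
  "fixed_point_free g \<longleftrightarrow> (\<forall>x\<in>N. conjby g x = x \<longrightarrow> x = \<one>)"

lemma trace_fixed_point_free: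
  assumes "y \<in> carrier G" "y [^] (s::nat) = \<one>" "x \<in> N" "fixed_point_free y"
  shows "trace y s x = \<one>"
  using assms trace_invariant trace_mem unfolding fixed_point_free_def by blast

text \<open>
  Consider the \<open>b * s\<close> conjugates of \<open>x\<close> under the powers \<open>y i [^] j\<close> as a matrix. The product over
  a row is a trace of \<open>y i\<close>, hence trivial. The product over a column with \<open>j > 0\<close> is a trace of
  some fixed point free \<open>c\<close>, hence trivial as well, while the column \<open>j = 0\<close> gives \<open>x [^] b\<close>. The
  two applications below are partitions of a group into cyclic subgroups: the \<open>y i\<close> generate the
  lines of a plane that differ from \<open>\<langle>c\<rangle>\<close>, or the complements of a Frobenius group with kernel
  \<open>\<langle>c\<rangle>\<close>.
\<close>

lemma fixed_point_free_partition:
  fixes y :: "nat \<Rightarrow> 'a" and b s :: nat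
  assumes y: "\<And>i. i < b \<Longrightarrow> y i \<in> carrier G \<and> y i [^] s = \<one> \<and> fixed_point_free (y i)"
    and s: "s > 0"
    and layer: "\<And>j. 0 < j \<Longrightarrow> j < s \<Longrightarrow> \<exists>c w. c \<in> carrier G \<and> w \<in> carrier G \<and> c [^] b = \<one> \<and>
        fixed_point_free c \<and> (\<forall>i<b. y i [^] j = c [^] i \<otimes> w)"
    and x: "x \<in> N"
  shows "x [^] b = \<one>"
proof -
  let ?f = "\<lambda>i j::nat. conjby (y i [^] j) x"
  have f: "?f i j \<in> N" if "i < b" for i j using y[OF that] x by (simp add: N_conjby)
  have layer1: "seqprod (\<lambda>i. ?f i j) b = \<one>" if j: "0 < j" "j < s" for j
  proof -
    obtain c w where c: "c \<in> carrier G" "w \<in> carrier G" "c [^] b = \<one>" "fixed_point_free c"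
      and eq: "\<And>i. i < b \<Longrightarrow> y i [^] j = c [^] i \<otimes> w" using layer[OF j] by blast
    have "seqprod (\<lambda>i. ?f i j) b = trace c b (conjby w x)"
      unfolding trace_def
      by (rule seqprod_cong) (use c eq x N_carrier in \<open>simp add: conjby_comp\<close>)
    also have "\<dots> = \<one>" using c x by (intro trace_fixed_point_free N_conjby)
    finally show ?thesis .
  qed
  have "\<one> = seqprod (\<lambda>i. trace (y i) s x) b"
    using y x by (subst seqprod_cong[where g = "\<lambda>i. \<one>"]) (simp_all add: trace_fixed_point_free seqprod_one)
  also have "\<dots> = seqprod (\<lambda>j. seqprod (\<lambda>i. ?f i j) b) s"
    unfolding trace_def by (rule seqprod_swap) (rule f)
  also have "\<dots> = x [^] b"
  proof -
    have "seqprod (\<lambda>j. seqprod (\<lambda>i. ?f i j) b) k = x [^] b" if "0 < k" "k \<le> s" for k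
      using that
    proof (induction k)
      case (Suc k)
      show ?case
      proof (cases "k = 0")
        case True
        then show ?thesis using x N_carrier by (simp add: seqprod_const)
      next
        case False
        then show ?thesis using Suc layer1[of k] x N_carrier by simp
      qed
    qed simp
    then show ?thesis using s by blast
  qed
  finally show ?thesis by simp
qed

lemma coprime_exponent_trivial:
  assumes "x \<in> N" "x [^] (b::nat) = \<one>" "prime b" "b \<noteq> p"
  shows "x = \<one>"
proof (rule ccontr)
  assume "x \<noteq> \<one>"
  then have "p dvd b" using ord_N[OF assms(1)] pow_eq_id[OF N_carrier[OF assms(1)], of b] assms(2) by simp
  then show False using p assms primes_dvd_imp_eq by blast
qed

text \<open>
  A noncyclic abelian \<open>b\<close>-group does not act fixed point freely: the group spanned by \<open>c\<close> and \<open>y\<close>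
  is partitioned by \<open>\<langle>c\<rangle>\<close> and the subgroups generated by \<open>c [^] i \<otimes> y\<close> for \<open>i < b\<close>.
\<close>

lemma fixed_point_of_noncyclic:
  assumes b: "prime b" "b \<noteq> p" and c: "c \<in> carrier G" "ord c = b" and y: "y \<in> carrier G" "ord y = b"
    and comm: "c \<otimes> y = y \<otimes> c" and ncyc: "y \<notin> cyc c" and N1: "N \<noteq> {\<one>}"
  shows "\<not> fixed_point_free c \<or> (\<exists>i::nat. \<not> fixed_point_free (c [^] i \<otimes> y))"
proof (rule ccontr)
  assume n: "\<not> ?thesis"
  obtain x where x: "x \<in> N" "x \<noteq> \<one>" using N1 N_one by blast
  have pw: "(c [^] i \<otimes> y) [^] j = (c [^] j) [^] i \<otimes> y [^] j" for i j :: nat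
  proof -
    have "c [^] i \<otimes> y = y \<otimes> c [^] i"
      using comm_cyc[of y c "c [^] i"] comm c(1) y(1) mem_cyc_iff[OF c(1), of "c [^] i"] by metis
    then have "(c [^] i \<otimes> y) [^] j = (c [^] i) [^] j \<otimes> y [^] j"
      using c y by (intro pow_mult_distrib) auto
    then show ?thesis using c by (simp add: nat_pow_pow mult.commute)
  qed
  have "x [^] b = \<one>"
  proof (rule fixed_point_free_partition[of b "\<lambda>i. c [^] i \<otimes> y" b])
    show "c [^] i \<otimes> y \<in> carrier G \<and> (c [^] i \<otimes> y) [^] b = \<one> \<and> fixed_point_free (c [^] i \<otimes> y)" for i :: nat
      using n c y pw[of i b] pow_ord_eq_1[of c] pow_ord_eq_1[of y] by simp
    show "b > 0" using b prime_gt_0_nat by blast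
    show "\<exists>d w. d \<in> carrier G \<and> w \<in> carrier G \<and> d [^] b = \<one> \<and>
        fixed_point_free d \<and> (\<forall>i<b. (c [^] i \<otimes> y) [^] j = d [^] i \<otimes> w)" if j: "0 < j" "j < b" for j
    proof (intro exI conjI allI impI)
      show "c [^] j \<in> carrier G" "y [^] j \<in> carrier G" using c y by auto
      have "c [^] j \<noteq> \<one>" using j c pow_eq_id[of c j] by (auto dest: dvd_imp_le)
      then have e: "cyc (c [^] j) = cyc c"
        using cyc_eqI_prime[of c "c [^] j"] c b mem_cyc_iff[of c] by auto
      show "(c [^] j) [^] b = \<one>" using c pow_ord_eq_1[of c] by (metis mult.commute nat_pow_one nat_pow_pow)
      show "fixed_point_free (c [^] j)" unfolding fixed_point_free_def
      proof (intro ballI impI)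
        fix z assume z: "z \<in> N" "conjby (c [^] j) z = z"
        then have "z \<otimes> c = c \<otimes> z"
          using comm_cyc[of z "c [^] j" c] e cyc_self c N_carrier[OF z(1)] by (simp add: conjby_eq_self_iff)
        then have "conjby c z = z" using c z N_carrier by (simp add: conjby_eq_self_iff)
        then show "z = \<one>" using n z unfolding fixed_point_free_def by blast
      qed
    qed (rule pw)
  qed (rule x)
  then show False using coprime_exponent_trivial x b by blast
qed

text \<open>
  The Frobenius group spanned by its kernel \<open>\<langle>c\<rangle>\<close> and its complement \<open>\<langle>u\<rangle>\<close> is partitioned by the
  kernel and the \<open>b\<close> conjugates of the complement; if the kernel has no fixed points on \<open>N\<close>, the
  complement has some.
\<close>

lemma fixed_point_of_frobenius:
  assumes b: "prime b" "b \<noteq> p" and c: "c \<in> carrier G" "ord c = b" "fixed_point_free c"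
    and u: "u \<in> carrier G" "prime (ord u)" "conjby u c \<in> cyc c" "conjby u c \<noteq> c"
    and N1: "N \<noteq> {\<one>}"
  shows "\<not> fixed_point_free u"
proof
  assume n: "fixed_point_free u"
  obtain x where x: "x \<in> N" "x \<noteq> \<one>" using N1 N_one by blast
  have inC: "conjby (u [^] j) c \<in> cyc c" for j :: nat
  proof (induction j)
    case 0 then show ?case using c cyc_self by simp
  next
    case (Suc j)
    have "conjby (u [^] Suc j) c = conjby u (conjby (u [^] j) c)"
      using u c by (subst nat_pow_Suc2) (simp_all add: conjby_comp)
    also have "\<dots> \<in> conjby u ` cyc c" using Suc by blast
    also have "\<dots> = cyc (conjby u c)" using cyc_conjby[OF u(1) c(1)] by simp
    also have "\<dots> \<subseteq> cyc c" using cyc_sub c u by blast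
    finally show ?case .
  qed
  have "x [^] b = \<one>"
  proof (rule fixed_point_free_partition[of b "\<lambda>i. conjby (c [^] i) u" "ord u"])
    fix i assume "i < b"
    have "fixed_point_free (conjby (c [^] i) u)" unfolding fixed_point_free_def
    proof (intro ballI impI)
      fix z assume z: "z \<in> N" "conjby (conjby (c [^] i) u) z = z"
      let ?z = "conjby (inv (c [^] i)) z"
      have zz: "?z \<in> N" "z = conjby (c [^] i) ?z" using z c N_carrier by (simp_all add: N_conjby)
      have "conjby (c [^] i) u \<otimes> conjby (c [^] i) ?z = conjby (c [^] i) ?z \<otimes> conjby (c [^] i) u"
        using z zz N_carrier c u by (simp add: conjby_eq_self_iff)
      then have "conjby u ?z = ?z"
        using conjby_comm[of "c [^] i" u ?z] u c zz N_carrier by (simp add: conjby_eq_self_iff)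
      then have "?z = \<one>" using n zz unfolding fixed_point_free_def by blast
      then show "z = \<one>" using zz(2) c by simp
    qed
    then show "conjby (c [^] i) u \<in> carrier G \<and> conjby (c [^] i) u [^] ord u = \<one> \<and>
      fixed_point_free (conjby (c [^] i) u)"
      using c u by (simp flip: conjby_pow)
  next
    show "ord u > 0" using u prime_gt_0_nat by blast
    fix j assume j: "0 < j" "j < ord u"
    \<comment> \<open>Moving \<open>u [^] j\<close> to the right in \<open>c [^] i \<otimes> u [^] j \<otimes> inv (c [^] i)\<close> leaves a power of
      \<open>?d\<close>, the commutator of \<open>c\<close> and \<open>u [^] j\<close>.\<close>
    let ?e = "conjby (u [^] j) (inv c)" let ?d = "c \<otimes> ?e"
    have e: "?e \<in> cyc c" using inC[of j] subgroup.m_inv_closed[OF cyc_subgroup[OF c(1)]] u c by (simp add: conjby_inv)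
    have d: "?d \<in> cyc c" using e cyc_self subgroup.m_closed[OF cyc_subgroup[OF c(1)]] by blast
    have "?d \<noteq> \<one>"
    proof
      assume "?d = \<one>"
      then have "conjby (u [^] j) c = c" using u c by (simp add: conjby_inv) (metis conjby_closed inv_closed inv_equality inv_inv nat_pow_closed)
      then have "c \<otimes> u [^] j = u [^] j \<otimes> c" using u c by (simp add: conjby_eq_self_iff)
      moreover have "u \<in> cyc (u [^] j)"
      proof -
        have "u [^] j \<noteq> \<one>" using j u pow_eq_id[of u j] by (auto dest: dvd_imp_le)
        then have "cyc (u [^] j) = cyc u" using cyc_eqI_prime[of u "u [^] j"] u mem_cyc_iff[of u] by auto
        then show ?thesis using cyc_self by simp
      qed
      ultimately have "c \<otimes> u = u \<otimes> c" using comm_cyc[of c "u [^] j" u] u c by simp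
      then show False using u c by (simp add: conjby_eq_self_iff)
    qed
    then have cd: "cyc ?d = cyc c" using cyc_eqI_prime[of c ?d] d c b by simp
    show "\<exists>d w. d \<in> carrier G \<and> w \<in> carrier G \<and> d [^] b = \<one> \<and>
        fixed_point_free d \<and> (\<forall>i<b. conjby (c [^] i) u [^] j = d [^] i \<otimes> w)"
    proof (rule exI[of _ ?d], rule exI[of _ "u [^] j"], intro conjI allI impI)
      show dc: "?d \<in> carrier G" using c u by auto
      show "u [^] j \<in> carrier G" using u by auto
      have "ord ?d = b" using cyc_eq_ord[OF dc c(1) cd] c by simp
      then show "?d [^] b = \<one>" using dc pow_ord_eq_1 by metis
      show "fixed_point_free ?d" unfolding fixed_point_free_def
      proof (intro ballI impI)
        fix z assume z: "z \<in> N" "conjby ?d z = z"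
        then have "z \<otimes> c = c \<otimes> z"
          using comm_cyc[of z ?d c] cd cyc_self c dc N_carrier[OF z(1)] by (simp add: conjby_eq_self_iff)
        then have "conjby c z = z" using c z N_carrier by (simp add: conjby_eq_self_iff)
        then show "z = \<one>" using c z unfolding fixed_point_free_def by blast
      qed
      fix i assume "i < b"
      have ce: "c \<otimes> ?e = ?e \<otimes> c" using comm_cyc[of c c ?e] e c by simp
      have "?d [^] i = c [^] i \<otimes> ?e [^] i" using ce c u by (intro pow_mult_distrib) auto
      also have "?e [^] i = u [^] j \<otimes> inv (c [^] i) \<otimes> inv (u [^] j)"
        using c u by (simp add: nat_pow_inv flip: conjby_pow) (simp add: conjby_def)
      finally have "?d [^] i \<otimes> u [^] j = c [^] i \<otimes> u [^] j \<otimes> inv (c [^] i)"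
        using c u by (simp add: m_assoc)
      also have "\<dots> = conjby (c [^] i) u [^] j" using c u by (simp flip: conjby_pow) (simp add: conjby_def)
      finally show "conjby (c [^] i) u [^] j = ?d [^] i \<otimes> u [^] j" by simp
    qed
  qed (rule x)
  then show False using coprime_exponent_trivial x b by blast
qed

end

section \<open>Elements normalising a cyclic subgroup\<close>

context finite_group begin

lemma normalizes_cyc_mult:
  assumes "z \<in> carrier G" "g \<in> carrier G" "h \<in> carrier G" "conjby g z \<in> cyc z" "conjby h z \<in> cyc z"
  shows "conjby (g \<otimes> h) z \<in> cyc z"
proof -
  have "conjby g (conjby h z) \<in> conjby g ` cyc z" using assms by blast
  also have "\<dots> \<subseteq> cyc z" using assms cyc_sub[of z "conjby g z"] by (simp flip: cyc_conjby)
  finally show ?thesis using assms by (simp add: conjby_comp)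
qed

lemma normalizes_cyc_pow:
  assumes "z \<in> carrier G" "g \<in> carrier G" "conjby g z \<in> cyc z"
  shows "conjby (g [^] (n::nat)) z \<in> cyc z"
  using assms by (induction n) (simp_all add: cyc_self normalizes_cyc_mult)

text \<open>
  The automorphism group of a cyclic group is abelian.
\<close>

lemma normalizes_cyc_commute:
  assumes z: "z \<in> carrier G" and g: "g \<in> carrier G" "conjby g z \<in> cyc z" and h: "h \<in> carrier G" "conjby h z \<in> cyc z"
  shows "conjby (g \<otimes> h) z = conjby (h \<otimes> g) z"
proof -
  obtain k l :: nat where "conjby g z = z [^] k" "conjby h z = z [^] l" using g h z mem_cyc_iff by blast
  then show ?thesis using g h z by (simp add: conjby_comp conjby_pow nat_pow_pow mult.commute)
qed

lemma normalizes_cyc_pow_mult: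
  assumes z: "z \<in> carrier G" and g: "g \<in> carrier G" "conjby g z \<in> cyc z" and h: "h \<in> carrier G" "conjby h z \<in> cyc z"
  shows "conjby ((g \<otimes> h) [^] (n::nat)) z = conjby (g [^] n) (conjby (h [^] n) z)"
proof -
  have pw: "conjby (x [^] n) z = z [^] (k ^ n)" if "x \<in> carrier G" "conjby x z = z [^] k" for x and k n :: nat
    using that z by (induction n) (simp_all add: conjby_comp conjby_pow nat_pow_pow mult.commute)
  obtain k l :: nat where kl: "conjby g z = z [^] k" "conjby h z = z [^] l" using g h z mem_cyc_iff by blast
  have "conjby (g \<otimes> h) z = z [^] (k * l)" using g h z kl by (simp add: conjby_comp conjby_pow nat_pow_pow)
  then have "conjby ((g \<otimes> h) [^] n) z = z [^] ((k * l) ^ n)" using pw[of "g \<otimes> h"] g h by simp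
  also have "\<dots> = conjby (g [^] n) (conjby (h [^] n) z)"
    using pw[OF g(1) kl(1)] pw[OF h(1) kl(2)] g h z by (simp add: conjby_pow nat_pow_pow power_mult_distrib)
  finally show ?thesis .
qed

lemma power_generates_prime_order:
  assumes "y \<in> carrier G" "prime (ord y)" "\<not> ord y dvd n"
  obtains k :: nat where "y = (y [^] (n::nat)) [^] k"
proof -
  have "y [^] n \<noteq> \<one>" using assms pow_eq_id by blast
  then have "cyc (y [^] n) = cyc y" using cyc_eqI_prime[of y "y [^] n"] assms mem_cyc_iff[of y] by auto
  then have "y \<in> cyc (y [^] n)" using cyc_self by simp
  then show ?thesis using that mem_cyc_iff assms(1) by (metis nat_pow_closed)
qed

text \<open>
  On \<open>\<langle>z\<rangle>\<close> the elements \<open>y\<close> and \<open>w\<close> act by commuting automorphisms whose orders are \<open>ord y\<close> and a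
  divisor of \<open>m\<close>. As these are coprime, \<open>ord y\<close> divides the order of the action of \<open>y \<otimes> w\<close>.
\<close>

lemma dvd_ord_mult_of_noncentral:
  assumes z: "z \<in> carrier G" and y: "y \<in> carrier G" "conjby y z \<in> cyc z" and w: "w \<in> carrier G" "conjby w z \<in> cyc z"
    and r: "prime (ord y)" "conjby y z \<noteq> z" and m: "conjby (w [^] (m::nat)) z = z" "\<not> ord y dvd m"
  shows "ord y dvd ord (y \<otimes> w)"
proof (rule ccontr)
  assume nd: "\<not> ord y dvd ord (y \<otimes> w)"
  let ?n = "ord (y \<otimes> w)"
  have "z = conjby ((y \<otimes> w) [^] (?n * m)) z"
    using z y w by (simp flip: nat_pow_pow)
  also have "\<dots> = conjby (y [^] (?n * m)) (conjby (w [^] (?n * m)) z)"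
    by (rule normalizes_cyc_pow_mult) (use z y w in auto)
  also have "conjby (w [^] (?n * m)) z = z"
    using conjby_fixes_pow[of "w [^] m" z ?n] m w z by (simp add: nat_pow_pow mult.commute)
  finally have fx: "conjby (y [^] (?n * m)) z = z" by simp
  have "\<not> ord y dvd ?n * m" using nd m r by (simp add: prime_dvd_mult_iff)
  then obtain k :: nat where "y = (y [^] (?n * m)) [^] k" using power_generates_prime_order[OF y(1) r(1)] by blast
  then have "conjby y z = z" using conjby_fixes_pow[of "y [^] (?n * m)" z k] fx y z by simp
  then show False using r by simp
qed

lemma ord_mult_commute:
  assumes "a \<in> carrier G" "b \<in> carrier G"
  shows "ord (a \<otimes> b) = ord (b \<otimes> a)"
proof -
  have "conjby a (b \<otimes> a) = a \<otimes> b" using assms by (simp add: conjby_def m_assoc)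
  then show ?thesis using assms ord_conjby[of a "b \<otimes> a"] by simp
qed

end

context claw_free_group begin

text \<open>
  The product of the three elements has an order divisible by all three primes, although they need
  not commute with each other: only their actions on \<open>\<langle>z\<rangle>\<close> do.
\<close>

lemma three_noncentral_contradiction:
  assumes z: "z \<in> carrier G"
    and y: "\<And>i. i \<in> {1, 2, 3::nat} \<Longrightarrow> y i \<in> carrier G \<and> prime (ord (y i)) \<and> conjby (y i) z \<in> cyc z \<and> conjby (y i) z \<noteq> z"
    and inj: "inj_on (\<lambda>i. ord (y i)) {1, 2, 3}"
  shows False
proof -
  have key: "ord (y i) dvd ord (y i \<otimes> (y j \<otimes> y k))" if ijk: "{i, j, k} = {1, 2, 3}" "i \<noteq> j" "i \<noteq> k" for i j k
  proof -
    have i: "i \<in> {1, 2, 3}" "j \<in> {1, 2, 3}" "k \<in> {1, 2, 3}" using ijk by auto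
    note yi = y[OF i(1)] and yj = y[OF i(2)] and yk = y[OF i(3)]
    have ne: "ord (y i) \<noteq> ord (y j)" "ord (y i) \<noteq> ord (y k)" using inj ijk(2,3) i unfolding inj_on_def by blast+
    show ?thesis
    proof (rule dvd_ord_mult_of_noncentral[OF z, of _ _ "ord (y j) * ord (y k)"])
      show "conjby (y j \<otimes> y k) z \<in> cyc z" by (rule normalizes_cyc_mult) (use z yj yk in auto)
      have "conjby ((y j \<otimes> y k) [^] (ord (y j) * ord (y k))) z
          = conjby (y j [^] (ord (y j) * ord (y k))) (conjby (y k [^] (ord (y j) * ord (y k))) z)"
        by (rule normalizes_cyc_pow_mult) (use z yj yk in auto)
      moreover have "a [^] n = \<one>" if "a \<in> carrier G" "ord a dvd n" for a and n :: nat
        using that pow_eq_id by simp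
      ultimately show "conjby ((y j \<otimes> y k) [^] (ord (y j) * ord (y k))) z = z"
        using z yj yk by simp
      show "\<not> ord (y i) dvd ord (y j) * ord (y k)"
        using yi yj yk ne by (metis prime_dvd_mult_iff primes_dvd_imp_eq)
    qed (use yi yj yk in auto)
  qed
  let ?g = "y 1 \<otimes> (y 2 \<otimes> y 3)"
  have c: "y 1 \<in> carrier G" "y 2 \<in> carrier G" "y 3 \<in> carrier G" using y by auto
  have "ord (y 1) dvd ord ?g" by (rule key) auto
  moreover have "ord (y 2) dvd ord (y 2 \<otimes> (y 3 \<otimes> y 1))" by (rule key) auto
  moreover have "ord (y 2 \<otimes> (y 3 \<otimes> y 1)) = ord ?g"
    using ord_mult_commute[of "y 2 \<otimes> y 3" "y 1"] c by (simp add: m_assoc)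
  moreover have "ord (y 3) dvd ord (y 3 \<otimes> (y 1 \<otimes> y 2))" by (rule key) auto
  moreover have "ord (y 3 \<otimes> (y 1 \<otimes> y 2)) = ord ?g"
    using ord_mult_commute[of "y 3" "y 1 \<otimes> y 2"] c by (simp add: m_assoc)
  ultimately have "\<And>i. i \<in> {1, 2, 3} \<Longrightarrow> ord (y i) dvd ord ?g" by auto
  then show False
    using no_three_primes_dvd_ord[of ?g "(\<lambda>i. ord (y i)) ` {1, 2, 3}"] inj y c by (auto simp: card_image)
qed

end

section \<open>An elementary abelian subgroup acting on another\<close>

text \<open>
  In the intended situation \<open>B\<close> is a Sylow subgroup of a normal subgroup of \<open>G\<close> whose other prime
  divisor is \<open>p\<close>, and \<open>N\<close> is the elementary abelian subgroup on which it acts by conjugation.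
\<close>

locale claw_free_tower = claw_free_group + elementary_abelian_normal +
  fixes B and b :: nat
  assumes elementary_abelian_B: "elementary_abelian b B" and b_neq_p: "b \<noteq> p"
    and N_nontrivial: "N \<noteq> {\<one>}" and B_nontrivial: "B \<noteq> {\<one>}"
begin

lemmas b = elementary_abelianD(1)[OF elementary_abelian_B] b_neq_p
  and B_subgroup = elementary_abelianD(2)[OF elementary_abelian_B]
  and B_comm = elementary_abelianD(3)[OF elementary_abelian_B]
  and B_exponent = elementary_abelianD(4)[OF elementary_abelian_B]

lemma B_carrier: "x \<in> B \<Longrightarrow> x \<in> carrier G" by (rule subgroup.mem_carrier[OF B_subgroup])

lemma ord_B: "x \<in> B \<Longrightarrow> x \<noteq> \<one> \<Longrightarrow> ord x = b"
  using B_exponent[of x] pow_eq_id[of x b] ord_eq_1[of x] B_carrier[of x] b prime_nat_iff by metis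

definition normalizes :: "'a \<Rightarrow> bool" where
  "normalizes g \<longleftrightarrow> g \<in> carrier G \<and> (\<forall>x\<in>B. conjby g x \<in> B)"

lemma normalizes_carrier: "normalizes g \<Longrightarrow> g \<in> carrier G" by (simp add: normalizes_def)

lemma normalizes_conjby: "normalizes g \<Longrightarrow> x \<in> B \<Longrightarrow> conjby g x \<in> B" by (simp add: normalizes_def)

lemma normalizes_mult: "normalizes g \<Longrightarrow> normalizes h \<Longrightarrow> normalizes (g \<otimes> h)"
  by (simp add: normalizes_def conjby_comp B_carrier)

lemma normalizes_pow: "normalizes g \<Longrightarrow> normalizes (g [^] (n::nat))"
  by (induction n) (simp_all add: normalizes_mult, simp add: normalizes_def B_carrier)

lemma B_normalizes: "x \<in> B \<Longrightarrow> normalizes x"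
  unfolding normalizes_def conjby_def
  using B_carrier subgroup.m_closed[OF B_subgroup] subgroup.m_inv_closed[OF B_subgroup] by simp

text \<open>
  The subgroups of order \<open>p\<close> and \<open>b\<close> generated by \<open>z\<close> and \<open>c\<close> are neighbours, one in \<open>N\<close> and one in
  \<open>B\<close>. By uniqueness of neighbours this is a bijection between the subgroups concerned.
\<close>

definition matched :: "'a \<Rightarrow> 'a \<Rightarrow> bool" where
  "matched z c \<longleftrightarrow> z \<in> N \<and> z \<noteq> \<one> \<and> c \<in> B \<and> c \<noteq> \<one> \<and> conjby c z = z"

lemma matchedD:
  assumes "matched z c"
  shows "z \<in> N" "z \<noteq> \<one>" "c \<in> B" "c \<noteq> \<one>" "conjby c z = z" "z \<in> carrier G" "c \<in> carrier G" "ord z = p" "ord c = b"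
    "c \<otimes> z = z \<otimes> c"
  using assms ord_N ord_B N_carrier B_carrier unfolding matched_def by (auto simp: conjby_eq_self_iff)

lemma matched_unique:
  assumes "matched z c" "matched z' c"
  shows "cyc z = cyc z'"
  using assms[THEN matchedD(6)] assms[THEN matchedD(7)] assms[THEN matchedD(8)] assms[THEN matchedD(9)]
    assms[THEN matchedD(10)] b p
  by (intro unique_prime_neighbour[of c]) auto

lemma prime_ord_commuting_with_B:
  assumes "matched z c" and y: "y \<in> carrier G" "prime (ord y)" "ord y \<noteq> b" "conjby y c = c"
  shows "ord y = p"
proof -
  note m = matchedD[OF assms(1)]
  have "c \<otimes> y = y \<otimes> c" using y m by (simp add: conjby_eq_self_iff)
  then have "cyc y = cyc z" using y m b p by (intro unique_prime_neighbour[of c]) auto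
  then show ?thesis using cyc_eq_ord y m by metis
qed

lemma prime_ord_commuting_with_N:
  assumes "matched z c" and y: "y \<in> carrier G" "prime (ord y)" "ord y \<noteq> p" "conjby y z = z"
  shows "ord y = b"
proof -
  note m = matchedD[OF assms(1)]
  have "z \<otimes> y = y \<otimes> z" using y m by (simp add: conjby_eq_self_iff)
  then have "cyc y = cyc c" using y m b p by (intro unique_prime_neighbour[of z]) auto
  then show ?thesis using cyc_eq_ord y m by metis
qed

lemma matched_conjby:
  assumes "matched z c" "normalizes g"
  shows "matched (conjby g z) (conjby g c)"
proof -
  note m = matchedD[OF assms(1)] and g = normalizes_carrier[OF assms(2)]
  have "conjby g c \<otimes> conjby g z = conjby g z \<otimes> conjby g c" using m g conjby_comm[of g c z] by simp
  then show ?thesis unfolding matched_def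
    using m g normalizes_conjby[OF assms(2)] by (simp add: N_conjby conjby_eq_self_iff)
qed

lemma matched_mem_cyc:
  assumes "matched z c" "x \<in> cyc z" "x \<noteq> \<one>"
  shows "matched x c"
proof -
  note m = matchedD[OF assms(1)]
  have "x \<in> N" using assms(2) m by (auto simp: mem_cyc_iff N_pow)
  moreover have "c \<otimes> x = x \<otimes> c" using comm_cyc m assms(2) by blast
  ultimately show ?thesis unfolding matched_def using m assms N_carrier by (simp add: conjby_eq_self_iff)
qed

text \<open>
  Since \<open>B\<close> is abelian, \<open>a\<close> fixes \<open>c\<close> and therefore permutes the neighbours of \<open>\<langle>c\<rangle>\<close>.
\<close>

lemma B_normalizes_matched:
  assumes "matched z c" "a \<in> B"
  shows "conjby a z \<in> cyc z"
proof -
  note m = matchedD[OF assms(1)]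
  have "conjby a c = c" using B_comm[OF assms(2) m(3)] B_carrier assms(2) m by (simp add: conjby_eq_self_iff)
  then have "matched (conjby a z) c" using matched_conjby[OF assms(1) B_normalizes[OF assms(2)]] by simp
  then show ?thesis using matched_unique[OF assms(1)] cyc_self by metis
qed

text \<open>
  Subgroups of order \<open>p\<close> are the one-dimensional subspaces of \<open>N\<close> as a vector space over the field
  with \<open>p\<close> elements.
\<close>

definition lines :: "'a set set" where
  "lines = {cyc z |z. \<exists>c. matched z c}"

lemma finite_lines: "finite lines"
proof (rule finite_subset)
  show "lines \<subseteq> Pow (carrier G)" unfolding lines_def using cyc_carrier matchedD(6) by blast
qed (simp add: fin)

text \<open>
  Without lines every nontrivial element of \<open>B\<close> is fixed point free on \<open>N\<close>, so \<open>B = \<langle>c\<rangle>\<close> is cyclic.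
  A prime \<open>q\<close> is called central if some element of order \<open>q\<close> normalises \<open>B\<close> and centralises it. Two
  central primes would give two neighbours of \<open>\<langle>c\<rangle>\<close>. Two noncentral primes give commuting elements
  \<open>u\<close> and \<open>v\<close>, and \<open>\<langle>u\<rangle>\<close> has both \<open>\<langle>v\<rangle>\<close> and a subgroup of \<open>N\<close> as neighbours. Three primes cannot
  avoid both situations.
\<close>

lemma lines_nonempty:
  assumes y: "\<And>i. i \<in> {1, 2, 3::nat} \<Longrightarrow> normalizes (y i) \<and> prime (ord (y i)) \<and> ord (y i) \<noteq> p \<and> ord (y i) \<noteq> b"
    and inj: "inj_on (\<lambda>i. ord (y i)) {1, 2, 3}"
  shows "lines \<noteq> {}"
proof
  assume "lines = {}"
  then have nm: "\<not> matched z c" for z c by (auto simp: lines_def)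
  have fpf: "fixed_point_free c" if "c \<in> B" "c \<noteq> \<one>" for c
    using nm[of _ c] that unfolding fixed_point_free_def matched_def by blast
  obtain c where c: "c \<in> B" "c \<noteq> \<one>" using B_nontrivial subgroup.one_closed[OF B_subgroup] by blast
  have cc: "c \<in> carrier G" "ord c = b" using c B_carrier ord_B by auto
  have Bc: "B \<subseteq> cyc c"
  proof (rule ccontr)
    assume "\<not> B \<subseteq> cyc c"
    then obtain d where d: "d \<in> B" "d \<notin> cyc c" by blast
    then have "d \<noteq> \<one>" using subgroup.one_closed[OF cyc_subgroup[OF cc(1)]] by blast
    then have "\<not> fixed_point_free c \<or> (\<exists>i::nat. \<not> fixed_point_free (c [^] i \<otimes> d))"
      using fixed_point_of_noncyclic[OF b cc _ _ _ d(2) N_nontrivial] ord_B[OF d(1)] B_carrier[OF d(1)]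
        B_comm[OF c(1) d(1)] by simp
    then obtain i :: nat where i: "\<not> fixed_point_free (c [^] i \<otimes> d)" using fpf c by blast
    have ci: "c [^] i \<in> B" using c by (induction i) (simp_all add: subgroup.m_closed[OF B_subgroup] subgroup.one_closed[OF B_subgroup])
    then have "c [^] i \<otimes> d \<in> B" using d subgroup.m_closed[OF B_subgroup] by blast
    then have "c [^] i \<otimes> d = \<one>" using fpf i by blast
    then have "d = inv (c [^] i)" using cc d B_carrier
      by (metis inv_closed inv_equality inv_inv nat_pow_closed)
    moreover have "c [^] i \<in> cyc c" using mem_cyc_iff[OF cc(1)] by blast
    ultimately have "d \<in> cyc c" using subgroup.m_inv_closed[OF cyc_subgroup[OF cc(1)]] by blast
    then show False using d by blast
  qed
  define central where "central q \<longleftrightarrow> (\<exists>g. normalizes g \<and> ord g = q \<and> conjby g c = c)" for q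
  have one_central: "q = q'" if cen: "central q" "central q'" and "prime q" "prime q'" "q \<noteq> b" "q' \<noteq> b" for q q'
  proof -
    obtain g h where gh: "normalizes g" "ord g = q" "conjby g c = c" "normalizes h" "ord h = q'" "conjby h c = c"
      using cen unfolding central_def by blast
    note gc = gh(1,4)[THEN normalizes_carrier]
    have "cyc g = cyc h"
    proof (rule unique_prime_neighbour[of c])
      show "c \<otimes> g = g \<otimes> c" "c \<otimes> h = h \<otimes> c" using gh gc cc by (simp_all add: conjby_eq_self_iff)
    qed (use gh gc cc b that in auto)
    then show ?thesis using cyc_eq_ord gc gh by metis
  qed
  have two: False
    if g: "normalizes g" "prime (ord g)" "ord g \<noteq> p" "\<not> central (ord g)"
      and h: "normalizes h" "prime (ord h)" "ord h \<noteq> p" "\<not> central (ord h)" and ne: "ord g \<noteq> ord h" for g h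
  proof -
    note gc = g(1)[THEN normalizes_carrier] and hc = h(1)[THEN normalizes_carrier]
    have gz: "conjby g c \<in> cyc c" "conjby h c \<in> cyc c" using g h normalizes_conjby c Bc by blast+
    have gn: "conjby g c \<noteq> c" "conjby h c \<noteq> c" using g h unfolding central_def by blast+
    \<comment> \<open>Commuting elements of both orders are found among the powers of \<open>g \<otimes> h\<close>.\<close>
    let ?k = "g \<otimes> h"
    have kc: "?k \<in> carrier G" using gc hc by simp
    have "ord g dvd ord ?k"
      using dvd_ord_mult_of_noncentral[OF cc(1) gc gz(1) hc gz(2) g(2) gn(1), of "ord h"] hc cc ne g h
        primes_dvd_imp_eq by auto
    moreover have "ord h dvd ord (h \<otimes> g)"
      using dvd_ord_mult_of_noncentral[OF cc(1) hc gz(2) gc gz(1) h(2) gn(2), of "ord g"] gc cc ne[symmetric] g h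
        primes_dvd_imp_eq by auto
    ultimately have d: "ord g dvd ord ?k" "ord h dvd ord ?k" using ord_mult_commute gc hc by simp_all
    have opow: "ord (?k [^] (ord ?k div q)) = q" if "prime q" "q dvd ord ?k" for q
    proof -
      have "ord ?k div q > 0" "ord ?k div q dvd ord ?k" 
        using that prime_gt_0_nat[OF that(1)] ord_pos[OF kc] by (auto simp: div_greater_zero_iff dvd_imp_le elim!: dvdE)
      then show ?thesis using ord_pow[OF kc, of "ord ?k div q"] that ord_pos[OF kc] by (auto elim!: dvdE)
    qed
    define u where "u = ?k [^] (ord ?k div ord g)"
    define v where "v = ?k [^] (ord ?k div ord h)"
    have uv: "ord u = ord g" "ord v = ord h" "u \<in> carrier G" "v \<in> carrier G" using opow d g h kc by (auto simp: u_def v_def)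
    have nu: "normalizes u" unfolding u_def by (intro normalizes_pow normalizes_mult g h)
    then have "conjby u c \<noteq> c" using g uv unfolding central_def by blast
    moreover have "conjby u c \<in> cyc c" using normalizes_conjby[OF nu] c Bc by blast
    ultimately have "\<not> fixed_point_free u"
      using fixed_point_of_frobenius[OF b cc fpf[OF c] uv(3)] uv g N_nontrivial by simp
    then obtain x where x: "x \<in> N" "x \<noteq> \<one>" "conjby u x = x" unfolding fixed_point_free_def by blast
    have "cyc x = cyc v"
    proof (rule unique_prime_neighbour[of u])
      show "u \<otimes> v = v \<otimes> u" unfolding u_def v_def using kc by (simp add: nat_pow_mult add.commute)
      show "u \<otimes> x = x \<otimes> u" using x uv N_carrier by (simp add: conjby_eq_self_iff)
    qed (use uv g h x ord_N N_carrier p ne in auto)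
    then show False using cyc_eq_ord[of x v] uv x ord_N N_carrier h by auto
  qed
  have "central (ord (y i)) \<or> central (ord (y j))" if "i \<in> {1,2,3}" "j \<in> {1,2,3}" "i \<noteq> j" for i j
  proof (rule ccontr)
    assume "\<not> ?thesis"
    moreover have "ord (y i) \<noteq> ord (y j)" using inj that unfolding inj_on_def by blast
    ultimately show False using two[of "y i" "y j"] y[OF that(1)] y[OF that(2)] by blast
  qed
  moreover have "\<not> (central (ord (y i)) \<and> central (ord (y j)))" if "i \<in> {1,2,3}" "j \<in> {1,2,3}" "i \<noteq> j" for i j
  proof
    assume "central (ord (y i)) \<and> central (ord (y j))"
    moreover have "ord (y i) \<noteq> ord (y j)" using inj that unfolding inj_on_def by blast
    ultimately show False using one_central y[OF that(1)] y[OF that(2)] by blast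
  qed
  ultimately have x: "central (ord (y i)) \<noteq> central (ord (y j))" if "i \<in> {1,2,3}" "j \<in> {1,2,3}" "i \<noteq> j" for i j
    using that by blast
  have "central (ord (y 1)) \<noteq> central (ord (y 2))" by (rule x) auto
  moreover have "central (ord (y 2)) \<noteq> central (ord (y 3))" by (rule x) auto
  moreover have "central (ord (y 1)) \<noteq> central (ord (y 3))" by (rule x) auto
  ultimately show False by blast
qed

text \<open>
  A single line is invariant under everything that normalises \<open>B\<close>, and it is not centralised by
  elements of the three prime orders because its only neighbour has order \<open>b\<close>.
\<close>

lemma card_lines_neq_1:
  assumes y: "\<And>i. i \<in> {1, 2, 3::nat} \<Longrightarrow> normalizes (y i) \<and> prime (ord (y i)) \<and> ord (y i) \<noteq> p \<and> ord (y i) \<noteq> b"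
    and inj: "inj_on (\<lambda>i. ord (y i)) {1, 2, 3}"
  shows "card lines \<noteq> 1"
proof
  assume "card lines = 1"
  then obtain L where L: "lines = {L}" by (auto simp: card_1_singleton_iff)
  then have "L \<in> lines" by simp
  then obtain z c where m: "matched z c" "L = cyc z" unfolding lines_def by blast
  have "y i \<in> carrier G \<and> prime (ord (y i)) \<and> conjby (y i) z \<in> cyc z \<and> conjby (y i) z \<noteq> z"
    if i: "i \<in> {1, 2, 3}" for i
  proof (intro conjI)
    note yi = y[OF i]
    show yc: "y i \<in> carrier G" using yi by (simp add: normalizes_def)
    show "prime (ord (y i))" using yi by simp
    have "matched (conjby (y i) z) (conjby (y i) c)" using matched_conjby[OF m(1)] yi by simp
    then have "cyc (conjby (y i) z) \<in> lines" unfolding lines_def by blast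
    then have "cyc (conjby (y i) z) = cyc z" using L m(2) by simp
    then show "conjby (y i) z \<in> cyc z" using cyc_self[of "conjby (y i) z"] by simp
    show "conjby (y i) z \<noteq> z"
    proof
      assume "conjby (y i) z = z"
      then have "ord (y i) = b" using prime_ord_commuting_with_N[OF m(1) yc] yi by simp
      then show False using yi by simp
    qed
  qed
  then show False by (rule three_noncentral_contradiction[OF matchedD(6)[OF m(1)] _ inj])
qed

text \<open>
  If \<open>y\<close> leaves two lines invariant, the commutator of \<open>y\<close> with any element of \<open>B\<close> acts trivially on
  both, as automorphisms of a line commute. It lies in \<open>B\<close>, and a nontrivial element of \<open>B\<close> is matched
  with one line at most. So \<open>y\<close> centralises \<open>B\<close>, and \<open>\<langle>c\<rangle>\<close> has a neighbour besides its line.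
\<close>

lemma fixed_lines_unique:
  assumes m: "matched z c" "matched z' c'" and y: "normalizes y" "prime (ord y)" "ord y \<noteq> p" "ord y \<noteq> b"
    and inv: "conjby y z \<in> cyc z" "conjby y z' \<in> cyc z'"
  shows "cyc z = cyc z'"
proof (rule ccontr)
  assume ne: "cyc z \<noteq> cyc z'"
  note yc = normalizes_carrier[OF y(1)]
  have "conjby y a = a" if a: "a \<in> B" for a
  proof -
    have ac: "a \<in> carrier G" using a B_carrier by blast
    \<comment> \<open>The commutator \<open>a y a\<inverse> y\<inverse>\<close>.\<close>
    let ?d = "a \<otimes> inv (conjby y a)"
    have dB: "?d \<in> B"
      using a normalizes_conjby[OF y(1) a] subgroup.m_closed[OF B_subgroup] subgroup.m_inv_closed[OF B_subgroup] by blast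
    have fx: "\<exists>w. matched w x \<and> cyc w = cyc v \<and> conjby ?d w = w" if "matched v x" "conjby y v \<in> cyc v" for v x
    proof -
      note mv = matchedD[OF that(1)]
      have av: "conjby a v \<in> cyc v" by (rule B_normalizes_matched[OF that(1) a])
      \<comment> \<open>The commutator is the quotient of \<open>a \<otimes> y\<close> and \<open>y \<otimes> a\<close>, so it fixes images under \<open>y \<otimes> a\<close>;
        such an image generates the same line as \<open>v\<close>.\<close>
      let ?w = "conjby (y \<otimes> a) v"
      have "?w \<in> cyc v" by (rule normalizes_cyc_mult) (use mv ac yc av that in auto)
      moreover have "?w \<noteq> \<one>" using mv ac yc by simp
      moreover have "conjby ?d ?w = ?w"
      proof -
        have "?d \<otimes> (y \<otimes> a) = a \<otimes> y"
          using ac yc by (simp add: conjby_def inv_mult_group m_assoc) (simp add: ac yc flip: m_assoc)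
        then have "conjby ?d ?w = conjby (a \<otimes> y) v" using ac yc mv by (simp flip: conjby_comp)
        also have "\<dots> = ?w" by (rule normalizes_cyc_commute) (use mv ac yc av that in auto)
        finally show ?thesis .
      qed
      ultimately show ?thesis
        using matched_mem_cyc[OF that(1)] cyc_eqI_prime[of v ?w] mv p by metis
    qed
    have "?d = \<one>"
    proof (rule ccontr)
      assume d1: "?d \<noteq> \<one>"
      obtain w w' where w: "matched w c" "cyc w = cyc z" "conjby ?d w = w" "matched w' c'" "cyc w' = cyc z'" "conjby ?d w' = w'"
        using fx[OF m(1) inv(1)] fx[OF m(2) inv(2)] by blast
      then have "matched w ?d" "matched w' ?d" using dB d1 unfolding matched_def by auto
      then show False using matched_unique w ne by metis
    qed
    then show ?thesis using ac yc by (metis conjby_closed inv_closed inv_equality inv_inv)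
  qed
  then have "conjby y c = c" using matchedD(3)[OF m(1)] by blast
  then show False using prime_ord_commuting_with_B[OF m(1) yc] y by blast
qed

text \<open>
  The trace of \<open>c\<close> is a projection onto the line matched with \<open>c\<close>, up to the factor \<open>b\<close>; this is
  what makes different lines independent. The trace of \<open>z'\<close> lies in \<open>\<langle>z'\<rangle>\<close> because
  \<open>c\<close> leaves that line invariant, and in the line matched with \<open>c\<close> because \<open>c\<close> fixes it.
\<close>

lemma trace_other_line:
  assumes m: "matched z c" "matched z' c'" and ne: "cyc z \<noteq> cyc z'"
  shows "trace c b z' = \<one>"
proof (rule ccontr)
  assume t1: "trace c b z' \<noteq> \<one>"
  note mz = matchedD[OF m(1)] and mz' = matchedD[OF m(2)]
  let ?t = "trace c b z'"
  have "conjby c ?t = ?t" using mz mz' B_exponent by (intro trace_invariant) auto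
  then have "matched ?t c" using mz mz' t1 trace_mem unfolding matched_def by auto
  then have 1: "cyc ?t = cyc z" using matched_unique[OF _ m(1)] by blast
  have S: "subgroup (cyc z') G" using cyc_subgroup mz' by blast
  have j: "conjby (c [^] j) z' \<in> cyc z'" for j :: nat
    using normalizes_cyc_pow B_normalizes_matched[OF m(2) mz(3)] mz mz' by blast
  have "seqprod (\<lambda>j. conjby (c [^] j) z') k \<in> cyc z'" for k
    by (induction k) (simp_all add: subgroup.one_closed[OF S] subgroup.m_closed[OF S] j)
  then have "?t \<in> cyc z'" unfolding trace_def .
  then have "cyc ?t = cyc z'" using cyc_eqI_prime[of z' ?t] t1 mz' p by simp
  then show False using 1 ne by simp
qed

lemma matched_pow_b: "matched z c \<Longrightarrow> z [^] b \<noteq> \<one>"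
  using coprime_exponent_trivial[of z b] b matchedD(1,2) by blast

text \<open>
  A nontrivial power of \<open>y\<close> generates \<open>\<langle>y\<rangle>\<close>, so it moves every line that \<open>y\<close> moves.
\<close>

lemma moved_line_orbit:
  assumes m: "matched z c" and y: "normalizes y" "prime (ord y)"
    and mv: "conjby y z \<notin> cyc z"
  shows "inj_on (\<lambda>j::nat. cyc (conjby (y [^] j) z)) {..<ord y}"
proof (rule linorder_inj_onI)
  note yc = normalizes_carrier[OF y(1)] and mz = matchedD[OF m]
  fix i j :: nat assume ij: "i < j" "i \<in> {..<ord y}" "j \<in> {..<ord y}"
  show "cyc (conjby (y [^] i) z) \<noteq> cyc (conjby (y [^] j) z)"
  proof
    assume e: "cyc (conjby (y [^] i) z) = cyc (conjby (y [^] j) z)"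
    define d where "d = j - i"
    have "y [^] j = y [^] i \<otimes> y [^] d" using ij yc by (simp add: d_def nat_pow_mult)
    then have "conjby (y [^] j) z = conjby (y [^] i) (conjby (y [^] d) z)" using yc mz by (simp add: conjby_comp)
    moreover have "conjby (y [^] j) z \<in> conjby (y [^] i) ` cyc z"
      using e cyc_self[of "conjby (y [^] j) z"] cyc_conjby[of "y [^] i" z] yc mz by simp
    ultimately obtain x where x: "x \<in> cyc z" "conjby (y [^] i) (conjby (y [^] d) z) = conjby (y [^] i) x" by auto
    then have "conjby (y [^] d) z = x"
      using conjby_eq_iff[of "y [^] i" "conjby (y [^] d) z" x] cyc_carrier[of z x] yc mz by auto
    then have dz: "conjby (y [^] d) z \<in> cyc z" using x by simp
    have "\<not> ord y dvd d" using ij by (auto simp: d_def dest!: dvd_imp_le)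
    then obtain k :: nat where "y = (y [^] d) [^] k" using power_generates_prime_order yc y by metis
    then have "conjby y z \<in> cyc z" using normalizes_cyc_pow[of z "y [^] d" k] dz yc mz by simp
    then show False using mv by simp
  qed
qed auto

text \<open>
  The factors of \<open>trace y (ord y) z\<close> lie in different lines, and the projection to the line of \<open>z\<close>
  picks out the first of them.
\<close>

lemma trace_of_trace_moved_line:
  assumes m: "matched z c" and y: "normalizes y" "prime (ord y)" and mv: "conjby y z \<notin> cyc z"
  shows "trace c b (trace y (ord y) z) = z [^] b"
proof -
  note yc = normalizes_carrier[OF y(1)] and mz = matchedD[OF m]
  let ?f = "\<lambda>j::nat. trace c b (conjby (y [^] j) z)"
  have "trace c b (trace y (ord y) z) = seqprod ?f (ord y)"
    unfolding trace_def[of y] using mz yc by (intro trace_seqprod) (auto simp: N_conjby)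
  moreover have "seqprod ?f k = z [^] b" if "0 < k" "k \<le> ord y" for k
    using that
  proof (induction k)
    case (Suc k)
    show ?case
    proof (cases "k = 0")
      case True
      then show ?thesis using mz by (simp add: trace_fixed_point)
    next
      case False
      have "cyc (conjby (y [^] (0::nat)) z) \<noteq> cyc (conjby (y [^] k) z)"
        using inj_onD[OF moved_line_orbit[OF m y mv], of 0 k] False Suc.prems by auto
      then have "?f k = \<one>"
        using trace_other_line[OF m matched_conjby[OF m normalizes_pow[OF y(1)]]] mz by simp
      then show ?thesis using Suc False mz by simp
    qed
  qed simp
  ultimately show ?thesis using y(2) prime_gt_0_nat by auto
qed

text \<open>
  The traces under \<open>y\<close> of generators of two moved lines are fixed by \<open>y\<close>, so they generate the same
  neighbour of \<open>\<langle>y\<rangle>\<close>. The projection to the second line does not kill the second trace; so it does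
  not kill the first one, and the second line lies in the orbit of the first.
\<close>

lemma moved_lines_one_orbit:
  assumes m: "matched z c" "matched z' c'" and y: "normalizes y" "prime (ord y)" "ord y \<noteq> p"
    and mv: "conjby y z \<notin> cyc z" "conjby y z' \<notin> cyc z'"
  shows "cyc z' \<in> (\<lambda>j::nat. cyc (conjby (y [^] j) z)) ` {..<ord y}"
proof (rule ccontr)
  assume n: "\<not> ?thesis"
  note yc = normalizes_carrier[OF y(1)] and mz = matchedD[OF m(1)] and mz' = matchedD[OF m(2)]
  let ?v = "trace y (ord y) z" and ?v' = "trace y (ord y) z'"
  have vN: "?v \<in> N" "?v' \<in> N" using mz mz' yc by (auto intro: trace_mem)
  have t: "trace c b ?v = z [^] b" "trace c' b ?v' = z' [^] b"
    using trace_of_trace_moved_line m y mv by blast+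
  have v1: "?v \<noteq> \<one>" "?v' \<noteq> \<one>"
    using t matched_pow_b[OF m(1)] matched_pow_b[OF m(2)] mz mz' trace_one by metis+
  have inv: "conjby y ?v = ?v" "conjby y ?v' = ?v'" using yc mz mz' by (auto intro: trace_invariant)
  have "cyc ?v = cyc ?v'"
  proof (rule unique_prime_neighbour[of y])
    show "y \<otimes> ?v = ?v \<otimes> y" "y \<otimes> ?v' = ?v' \<otimes> y"
      using inv yc vN N_carrier by (simp_all add: conjby_eq_self_iff)
  qed (use vN v1 N_carrier ord_N p y yc in auto)
  then have "?v' \<in> cyc ?v" using cyc_self by simp
  then obtain k :: nat where k: "?v' = ?v [^] k" using mem_cyc_iff vN N_carrier by blast
  have "trace c' b ?v = seqprod (\<lambda>j. trace c' b (conjby (y [^] j) z)) (ord y)"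
    unfolding trace_def[of y] using mz mz' yc by (intro trace_seqprod) (auto simp: N_conjby)
  also have "\<dots> = seqprod (\<lambda>j. \<one>) (ord y)"
  proof (rule seqprod_cong)
    fix j assume "j < ord y"
    then have "cyc z' \<noteq> cyc (conjby (y [^] j) z)" using n by blast
    then show "trace c' b (conjby (y [^] j) z) = \<one>"
      using trace_other_line[OF m(2) matched_conjby[OF m(1) normalizes_pow[OF y(1)]]] by blast
  qed
  finally have "trace c' b ?v = \<one>" by (simp add: seqprod_one)
  then have "trace c' b ?v' = \<one>" using k trace_pow[of c' ?v b k] mz' vN by simp
  then show False using t matched_pow_b[OF m(2)] by simp
qed

text \<open>
  There is one orbit of \<open>ord y\<close> moved lines, and at most one line is left invariant.
\<close>

lemma card_lines:
  assumes ge2: "card lines \<ge> 2" and y: "normalizes y" "prime (ord y)" "ord y \<noteq> p" "ord y \<noteq> b"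
  shows "card lines = ord y \<or> card lines = ord y + 1"
proof -
  note yc = normalizes_carrier[OF y(1)]
  define moved where "moved L \<longleftrightarrow> (\<exists>z c. matched z c \<and> L = cyc z \<and> conjby y z \<notin> cyc z)" for L
  have fixed: "L = L'" if "L \<in> lines" "L' \<in> lines" "\<not> moved L" "\<not> moved L'" for L L'
    using that fixed_lines_unique[OF _ _ y] unfolding lines_def moved_def by blast
  obtain L where L: "L \<in> lines" "moved L"
  proof -
    obtain L L' where "L \<in> lines" "L' \<in> lines" "L \<noteq> L'"
      using ge2 card_le_Suc0_iff_eq[OF finite_lines] by auto
    then show ?thesis using that fixed by blast
  qed
  then obtain z c where z: "matched z c" "L = cyc z" "conjby y z \<notin> cyc z" unfolding moved_def by blast
  let ?O = "(\<lambda>j::nat. cyc (conjby (y [^] j) z)) ` {..<ord y}"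
  have O: "?O \<subseteq> lines" using matched_conjby[OF z(1) normalizes_pow[OF y(1)]] unfolding lines_def by blast
  have cO: "card ?O = ord y" using moved_line_orbit[OF z(1) y(1,2) z(3)] by (simp add: card_image)
  have "\<not> moved L'" if "L' \<in> lines - ?O" for L'
    using moved_lines_one_orbit[OF z(1) _ y(1-3) z(3)] that unfolding moved_def by blast
  then have "card (lines - ?O) \<le> 1"
    using fixed finite_lines by (intro card_le_Suc0_iff_eq[THEN iffD2, simplified One_nat_def[symmetric]]) auto
  moreover have "card lines = card ?O + card (lines - ?O)"
    using O finite_lines by (metis card_Diff_subset card_mono finite_subset le_add_diff_inverse)
  ultimately show ?thesis using cO by linarith
qed

theorem no_three_normalizing_primes:
  assumes y: "\<And>i. i \<in> {1, 2, 3::nat} \<Longrightarrow> normalizes (y i) \<and> prime (ord (y i)) \<and> ord (y i) \<noteq> p \<and> ord (y i) \<noteq> b"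
    and inj: "inj_on (\<lambda>i. ord (y i)) {1, 2, 3}"
  shows False
proof -
  have "lines \<noteq> {}" by (rule lines_nonempty[OF y inj])
  then have "card lines \<noteq> 0" using finite_lines by simp
  moreover have "card lines \<noteq> 1" by (rule card_lines_neq_1[OF y inj])
  ultimately have "card lines \<ge> 2" by linarith
  then have "card lines = ord (y i) \<or> card lines = ord (y i) + 1" if "i \<in> {1, 2, 3}" for i
    using card_lines[of "y i"] y[OF that] by simp
  from this[of 1] this[of 2] this[of 3] have
    "card lines = ord (y 1) \<or> card lines = ord (y 1) + 1"
    "card lines = ord (y 2) \<or> card lines = ord (y 2) + 1"
    "card lines = ord (y 3) \<or> card lines = ord (y 3) + 1" by auto
  moreover have "ord (y 1) \<noteq> ord (y 2)" "ord (y 2) \<noteq> ord (y 3)" "ord (y 1) \<noteq> ord (y 3)"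
    using inj by (auto simp: inj_on_def)
  ultimately show False by linarith
qed

end

section \<open>Sylow conjugacy and the Frattini argument\<close>

text \<open>
  All orbits have a power of \<open>q\<close> as cardinality, and not all of these cardinalities are multiples of
  \<open>q\<close>.
\<close>

lemma group_action_fixed_point:
  assumes act: "group_action G E \<phi>" and q: "prime q" "order G = q ^ m" and E: "finite E" "\<not> q dvd card E"
  shows "\<exists>x\<in>E. \<forall>g\<in>carrier G. \<phi> g x = x"
proof (rule ccontr)
  assume n: "\<not> ?thesis"
  interpret group_action G E \<phi> by fact
  have "q dvd card (orbit G \<phi> x)" if x: "x \<in> E" for x
  proof -
    have "card (orbit G \<phi> x) dvd q ^ m" using orbit_stabilizer_theorem[OF x] q by (metis dvd_triv_left)
    then obtain i where i: "card (orbit G \<phi> x) = q ^ i" using q divides_primepow_nat by blast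
    have "i \<noteq> 0"
    proof
      assume "i = 0"
      then obtain z where z: "orbit G \<phi> x = {z}" using i by (auto simp: card_1_singleton_iff)
      moreover have "x \<in> orbit G \<phi> x" by (rule orbit_refl[OF x])
      ultimately have "orbit G \<phi> x = {x}" by simp
      then have "\<phi> g x = x" if "g \<in> carrier G" for g using that unfolding orbit_def by blast
      then show False using n x by blast
    qed
    then show ?thesis using i by (simp add: dvd_power)
  qed
  then have "q dvd (\<Sum>orb\<in>orbits G E \<phi>. card orb)" unfolding orbits_def by (intro dvd_sum) auto
  also have "(\<Sum>orb\<in>orbits G E \<phi>. card orb) = card E"
    using disjoint_sum[OF E(1), of "\<lambda>_. 1::nat"] by simp
  finally show False using E by simp
qed

context finite_group begin

lemma left_multiplication_action:
  assumes H: "subgroup H G" and B: "subgroup B G"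
  shows "group_action (G\<lparr>carrier := H\<rparr>) (lcosets B) (\<lambda>h. \<lambda>C\<in>lcosets B. h <# C)"
proof -
  let ?E = "lcosets B" and ?f = "\<lambda>h. \<lambda>C\<in>lcosets B. h <# C"
  interpret H: group "G\<lparr>carrier := H\<rparr>" by (rule subgroup_imp_group[OF H])
  have Bc: "B \<subseteq> carrier G" using B by (rule subgroup.subset)
  have E: "h <# C \<in> ?E" "C \<subseteq> carrier G" if "h \<in> carrier G" "C \<in> ?E" for h C
    using that Bc unfolding LCOSETS_def by (auto simp: lcos_m_assoc) (auto simp: l_coset_def)
  have comp: "g <# (h <# C) = (g \<otimes> h) <# C" if "g \<in> carrier G" "h \<in> carrier G" "C \<in> ?E" for g h C
    using that E by (simp add: lcos_m_assoc)
  have id: "\<one> <# C = C" if "C \<in> ?E" for C using E(2)[OF one_closed that] by (rule lcos_mult_one)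
  have bij: "?f h \<in> Bij ?E" if h: "h \<in> carrier G" for h
  proof -
    have "bij_betw (?f h) ?E ?E"
      by (rule bij_betw_byWitness[where f' = "?f (inv h)"]) (use h E comp id in \<open>auto\<close>)
    then show ?thesis by (simp add: Bij_def)
  qed
  have "?f (g \<otimes> h) = compose ?E (?f g) (?f h)" if "g \<in> carrier G" "h \<in> carrier G" for g h
    using that comp E by (intro ext) (auto simp: compose_def restrict_def)
  then have "?f \<in> hom (G\<lparr>carrier := H\<rparr>) (BijGroup ?E)"
    using bij subgroup.mem_carrier[OF H] by (auto simp: hom_def BijGroup_def)
  then show ?thesis
    unfolding group_action_def group_hom_def group_hom_axioms_def
    using H.is_group group_BijGroup by blast
qed

text \<open>
  Let \<open>H\<close> act on the left cosets of \<open>B\<close>. Their number \<open>c\<close> is prime to \<open>q\<close>, so there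
  is a fixed coset \<open>g <# B\<close>, which means that \<open>H\<close> is contained in the conjugate of \<open>B\<close> by \<open>g\<close>.
\<close>

lemma sylow_conjugate:
  assumes H: "subgroup H G" "card H = q ^ m" and B: "subgroup B G" "order G = card B * c" and q: "prime q" "\<not> q dvd c"
  shows "\<exists>g\<in>carrier G. \<forall>x\<in>H. conjby (inv g) x \<in> B"
proof -
  have fE: "finite (lcosets B)" using fin unfolding LCOSETS_def by simp
  have "card (lcosets B) * card B = card B * c" using l_lagrange[OF fin B(1)] B(2) by simp
  moreover have "card B > 0" using B(1) fin by (metis subgroup.finite_imp_card_positive)
  ultimately have "card (lcosets B) = c" by simp
  then obtain C where C: "C \<in> lcosets B" "\<And>h. h \<in> H \<Longrightarrow> h <# C = C"
    using group_action_fixed_point[OF left_multiplication_action[OF H(1) B(1)] q(1), of m] fE q(2) H(2)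
    by (auto simp: order_def)
  obtain g where g: "g \<in> carrier G" "C = g <# B" using C(1) unfolding LCOSETS_def by blast
  have "conjby (inv g) x \<in> B" if x: "x \<in> H" for x
  proof -
    have xc: "x \<in> carrier G" using H(1) x subgroup.mem_carrier by metis
    have "g \<in> C" using lcos_self[OF g(1) B(1)] g(2) by simp
    then have "x \<otimes> g \<in> x <# C" unfolding l_coset_def by blast
    then have "x \<otimes> g \<in> g <# B" using C(2)[OF x] g by simp
    then obtain y where y: "y \<in> B" "x \<otimes> g = g \<otimes> y" by (auto simp: l_coset_def)
    have yc: "y \<in> carrier G" using B(1) y subgroup.mem_carrier by metis
    have "inv g \<otimes> (x \<otimes> g) = y" using y g yc by (simp flip: m_assoc)
    then show ?thesis using y g xc by (simp add: conjby_def m_assoc)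
  qed
  then show ?thesis using g by blast
qed

lemma normal_conjby_iff: "N \<lhd> G \<longleftrightarrow> subgroup N G \<and> (\<forall>g\<in>carrier G. \<forall>x\<in>N. conjby g x \<in> N)"
  by (simp add: normal_inv_iff conjby_def)

lemma subgroup_conjby:
  assumes "subgroup B G" "g \<in> carrier G"
  shows "subgroup (conjby g ` B) G"
proof (rule subgroupI)
  have c: "x \<in> carrier G" if "x \<in> B" for x using that assms(1) subgroup.mem_carrier by metis
  show "conjby g ` B \<subseteq> carrier G" using c assms by auto
  show "conjby g ` B \<noteq> {}" using subgroup.one_closed[OF assms(1)] by blast
  show "inv a \<in> conjby g ` B" if "a \<in> conjby g ` B" for a
    using that c assms subgroup.m_inv_closed[OF assms(1)] by (auto simp flip: conjby_inv)
  show "a \<otimes> a' \<in> conjby g ` B" if "a \<in> conjby g ` B" "a' \<in> conjby g ` B" for a a'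
    using that c assms subgroup.m_closed[OF assms(1)] by (auto simp flip: conjby_mult)
qed

text \<open>
  The conjugate of \<open>B\<close> by \<open>g\<close> is again a Sylow subgroup of \<open>L\<close>, so some \<open>l \<in> L\<close> conjugates \<open>B\<close> to it,
  and \<open>inv l \<otimes> g\<close> normalises \<open>B\<close>.
\<close>

lemma frattini:
  assumes L: "L \<lhd> G" and B: "subgroup B G" "B \<subseteq> L" "card B = q ^ m" "card L = q ^ m * c" and q: "prime q" "\<not> q dvd c"
    and g: "g \<in> carrier G"
  shows "\<exists>l\<in>L. \<forall>x\<in>B. conjby (inv l \<otimes> g) x \<in> B"
proof -
  have LG: "subgroup L G" using L by (rule normal_imp_subgroup)
  interpret L: finite_group "G\<lparr>carrier := L\<rparr>"
    using subgroup_imp_group[OF LG] finite_subset[OF subgroup.subset[OF LG] fin]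
    by (simp add: finite_group_def finite_group_axioms_def)
  have Bc: "x \<in> carrier G" if "x \<in> B" for x using that B(1) subgroup.mem_carrier by metis
  have BgL: "conjby g ` B \<subseteq> L" using L B(2) g by (auto simp: normal_conjby_iff)
  have "inj_on (conjby g) B" using Bc g by (intro inj_onI) (simp add: conjby_eq_iff)
  then have "card (conjby g ` B) = q ^ m" using B by (simp add: card_image)
  moreover have "subgroup (conjby g ` B) (G\<lparr>carrier := L\<rparr>)" "subgroup B (G\<lparr>carrier := L\<rparr>)"
    using subgroup_incl LG subgroup_conjby[OF B(1) g] BgL B by auto
  ultimately obtain l where l: "l \<in> L" "\<forall>x\<in>conjby g ` B. L.conjby (inv\<^bsub>G\<lparr>carrier := L\<rparr>\<^esub> l) x \<in> B"
    using L.sylow_conjugate[of "conjby g ` B" q m B c] B q by (auto simp: order_def)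
  have lc: "l \<in> carrier G" using l LG subgroup.mem_carrier by metis
  have il: "inv\<^bsub>G\<lparr>carrier := L\<rparr>\<^esub> l = inv l" by (rule m_inv_consistent[OF LG l(1)])
  have "conjby (inv l \<otimes> g) x \<in> B" if x: "x \<in> B" for x
  proof -
    have "L.conjby (inv l) (conjby g x) \<in> B" using l x il by simp
    moreover have "L.conjby (inv l) (conjby g x) = conjby (inv l) (conjby g x)"
      using m_inv_consistent[OF LG] subgroup.m_inv_closed[OF LG l(1)] by (simp add: L.conjby_def conjby_def)
    ultimately show ?thesis using lc g Bc[OF x] by (simp add: conjby_comp)
  qed
  then show ?thesis using l by blast
qed

lemma ord_dvd_card_subgroup:
  assumes "subgroup H G" "x \<in> H"
  shows "ord x dvd card H"
proof -
  interpret H: group "G\<lparr>carrier := H\<rparr>" by (rule subgroup_imp_group[OF assms(1)])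
  have "x [^]\<^bsub>G\<lparr>carrier := H\<rparr>\<^esub> order (G\<lparr>carrier := H\<rparr>) = \<one>"
    using H.pow_order_eq_1[of x] assms by simp
  then show ?thesis
    using pow_eq_id[of x "card H"] subgroup.mem_carrier[OF assms] by (simp add: order_def nat_pow_consistent[symmetric])
qed

lemma cauchy_subgroup:
  assumes "subgroup H G" "prime q" "q dvd card H"
  obtains x where "x \<in> H" "ord x = q"
proof -
  interpret H: finite_group "G\<lparr>carrier := H\<rparr>"
    using subgroup_imp_group[OF assms(1)] finite_subset[OF subgroup.subset[OF assms(1)] fin]
    by (simp add: finite_group_def finite_group_axioms_def)
  obtain x where x: "x \<in> H" "H.ord x = q" using H.cauchy[of q] assms by (auto simp: order_def)
  have xc: "x \<in> carrier G" using x assms(1) subgroup.mem_carrier by metis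
  have "(x [^] n = \<one>) = (q dvd n)" for n :: nat
    using H.pow_eq_id[of x n] x by (simp add: nat_pow_consistent[symmetric])
  then have "ord x = q" using ord_unique[OF xc] by blast
  then show ?thesis using that x by blast
qed

text \<open>
  The elements \<open>x\<close> and \<open>inv l \<otimes> x\<close> agree modulo \<open>L\<close>, and \<open>x\<close> has order \<open>ord x\<close> there because it lies
  outside \<open>L\<close>.
\<close>

lemma coprime_order_transfer:
  assumes L: "L \<lhd> G" and x: "x \<in> carrier G" "prime (ord x)" "\<not> ord x dvd card L" and l: "l \<in> L"
  shows "ord x dvd ord (inv l \<otimes> x)"
proof (rule ccontr)
  assume n: "\<not> ?thesis"
  have LG: "subgroup L G" using L by (rule normal_imp_subgroup)
  have lc: "l \<in> carrier G" using l LG subgroup.mem_carrier by metis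
  define h where "h = inv l \<otimes> x"
  have hc: "h \<in> carrier G" and xh: "x = l \<otimes> h" using lc x by (simp_all add: h_def flip: m_assoc)
  have "x [^] k \<otimes> inv (h [^] k) \<in> L" for k :: nat
  proof (induction k)
    case (Suc k)
    have "x [^] Suc k \<otimes> inv (h [^] Suc k) = (x [^] k \<otimes> inv (h [^] k)) \<otimes> conjby (h [^] k) l"
    proof -
      have "x [^] Suc k \<otimes> inv (h [^] Suc k) = x [^] k \<otimes> (l \<otimes> h) \<otimes> (inv h \<otimes> inv (h [^] k))"
        using x hc xh by (simp add: inv_mult_group)
      also have "\<dots> = x [^] k \<otimes> l \<otimes> (h \<otimes> inv h) \<otimes> inv (h [^] k)"
        using x hc lc by (simp only: m_assoc m_closed inv_closed nat_pow_closed)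
      also have "\<dots> = (x [^] k \<otimes> inv (h [^] k)) \<otimes> conjby (h [^] k) l"
        using x hc lc by (simp add: conjby_def m_assoc) (simp flip: m_assoc)
      finally show ?thesis .
    qed
    then show ?case using Suc subgroup.m_closed[OF LG] conjby_mem_normal[OF L, of "h [^] k" l] hc l by simp
  qed (simp add: subgroup.one_closed[OF LG])
  from this[of "ord x"] have "inv (h [^] ord x) \<in> L" using x hc by simp
  then have hL: "h [^] ord x \<in> L" using subgroup.m_inv_closed[OF LG] hc by fastforce
  have "coprime (ord x) (ord h)" using n x(2) prime_imp_coprime h_def by blast
  then have "ord (h [^] ord x) = ord h" using pow_ord_eq_ord_iff[OF fin hc] by blast
  then have "card (cyc (h [^] ord x)) = card (cyc h)" using hc generate_pow_card by simp
  moreover have "cyc (h [^] ord x) \<subseteq> cyc h" by (rule cyc_sub) (use hc mem_cyc_iff in auto)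
  moreover have "finite (cyc h)" using finite_subset[OF subgroup.subset[OF cyc_subgroup[OF hc]] fin] .
  ultimately have "cyc (h [^] ord x) = cyc h" by (simp add: card_subset_eq)
  then have "h \<in> cyc (h [^] ord x)" using cyc_self by simp
  then have "h \<in> L" using generate_subgroup_incl[of "{h [^] ord x}" L] hL LG by blast
  then have "x \<in> L" using xh l subgroup.m_closed[OF LG] by blast
  then show False using ord_dvd_card_subgroup[OF LG] x by blast
qed

end

section \<open>Elementary abelian layers of a solvable group\<close>

context finite_group begin

text \<open>
  By Cauchy's theorem \<open>q\<close> is the only prime divisor.
\<close>

lemma card_elementary_abelian:
  assumes "elementary_abelian q H"
  shows "\<exists>m. card H = q ^ m"
proof -
  note q = elementary_abelianD(1,4)[OF assms] and H = elementary_abelianD(2)[OF assms]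
  have "card H > 0" using H fin by (metis subgroup.finite_imp_card_positive)
  then have "card H \<noteq> 0" by simp
  then obtain k where k: "card H = q ^ multiplicity q (card H) * k" "\<not> q dvd k"
    using multiplicity_decompose'[of "card H" q] q(1) by (metis not_prime_unit)
  have "k = 1"
  proof (rule ccontr)
    assume "k \<noteq> 1"
    then obtain r where r: "prime r" "r dvd k" using prime_factor_nat by blast
    then have "r dvd card H" using k(1) by (metis dvd_mult)
    then obtain x where x: "x \<in> H" "ord x = r" using cauchy_subgroup[OF H r(1)] by blast
    then have "r dvd q" using q(2)[OF x(1)] pow_eq_id[of x q] subgroup.mem_carrier[OF H x(1)] by simp
    then have "r = q" using r q primes_dvd_imp_eq by blast
    then show False using r k by simp
  qed
  then show ?thesis using k(1) by auto
qed

text \<open>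
  The last nontrivial term of the derived series is abelian, and its elements of order dividing a
  prime form a subgroup that is invariant under conjugation.
\<close>

lemma solvable_elementary_abelian_normal:
  assumes solv: "solvable G" and nt: "carrier G \<noteq> {\<one>}"
  obtains A q where "A \<lhd> G" "A \<noteq> {\<one>}" "elementary_abelian q A"
proof -
  let ?D = "\<lambda>n. (derived G ^^ n) (carrier G)"
  have D: "?D n \<lhd> G" for n
    by (induction n) (simp_all add: normal_self derived_is_normal)
  obtain n where "?D n = {\<one>}" using solv solvable_iff_trivial_derived_seq by blast
  then obtain n where n: "?D n = {\<one>}" "\<And>k. k < n \<Longrightarrow> ?D k \<noteq> {\<one>}"
    using exists_least_iff[of "\<lambda>n. ?D n = {\<one>}"] by auto
  have "n \<noteq> 0" using n(1) nt by (cases n) auto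
  then obtain k where k: "n = Suc k" by (cases n) auto
  define M where "M = ?D k"
  have M: "M \<lhd> G" "M \<noteq> {\<one>}" "derived G M = {\<one>}" using D n k by (auto simp: M_def)
  have MG: "subgroup M G" using M(1) by (rule normal_imp_subgroup)
  have Mc: "x \<in> carrier G" if "x \<in> M" for x using that MG subgroup.mem_carrier by metis
  have comm: "x \<otimes> y = y \<otimes> x" if "x \<in> M" "y \<in> M" for x y
  proof -
    have "x \<otimes> y \<otimes> inv x \<otimes> inv y \<in> derived_set G M" using that by blast
    then have "x \<otimes> y \<otimes> inv x \<otimes> inv y \<in> derived G M" unfolding derived_def by (rule generate.incl)
    then have "x \<otimes> y \<otimes> inv x \<otimes> inv y = \<one>" using M by simp
    then have "(x \<otimes> y) \<otimes> inv (y \<otimes> x) = \<one>" using Mc that by (simp add: inv_mult_group m_assoc)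
    then show ?thesis using Mc that by (metis inv_closed inv_equality inv_inv m_closed)
  qed
  have "card M \<noteq> 1"
    using M(2) subgroup.one_closed[OF MG] by (auto simp: card_1_singleton_iff)
  then obtain q where q: "prime q" "q dvd card M" using prime_factor_nat by blast
  then obtain x where x: "x \<in> M" "ord x = q" using cauchy_subgroup[OF MG] by blast
  define A where "A = {x \<in> M. x [^] q = \<one>}"
  have "subgroup A G"
  proof (rule subgroupI)
    show "A \<subseteq> carrier G" using Mc by (auto simp: A_def)
    show "A \<noteq> {}" using subgroup.one_closed[OF MG] by (auto simp: A_def)
    show "inv a \<in> A" if "a \<in> A" for a
      using that Mc subgroup.m_inv_closed[OF MG] by (auto simp: A_def nat_pow_inv)
    show "a \<otimes> a' \<in> A" if "a \<in> A" "a' \<in> A" for a a'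
      using that Mc subgroup.m_closed[OF MG] comm by (auto simp: A_def pow_mult_distrib)
  qed
  have "A \<lhd> G" unfolding normal_conjby_iff
  proof (intro conjI ballI)
    show "subgroup A G" by fact
    fix g x assume g: "g \<in> carrier G" and x: "x \<in> A"
    then have "conjby g x [^] q = \<one>" using Mc by (simp add: A_def flip: conjby_pow)
    then show "conjby g x \<in> A" using conjby_mem_normal[OF M(1) g] x by (simp add: A_def)
  qed
  moreover have "x \<in> A" using x Mc pow_ord_eq_1[of x] by (auto simp: A_def)
  moreover have "x \<noteq> \<one>" using x q by auto
  ultimately have "A \<noteq> {\<one>}" by blast
  moreover have "elementary_abelian q A"
    using q(1) comm \<open>subgroup A G\<close> unfolding elementary_abelian_def by (simp add: A_def)
  ultimately show ?thesis using that \<open>A \<lhd> G\<close> by blast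
qed

text \<open>
  The subgroup \<open>L\<close> is the preimage of an elementary abelian normal \<open>b\<close>-subgroup of \<open>G Mod P\<close>, and
  \<open>b \<noteq> p\<close> because \<open>P\<close> is largest. A Sylow \<open>b\<close>-subgroup \<open>B\<close> of \<open>L\<close> meets \<open>P\<close> trivially, hence embeds
  into the quotient and is elementary abelian.
\<close>

lemma elementary_abelian_layer:
  assumes solv: "solvable G" and p: "prime p" and P: "P \<lhd> G" "card P = p ^ a" "P \<noteq> carrier G"
    and max: "\<And>P' i. P' \<lhd> G \<Longrightarrow> card P' = p ^ i \<Longrightarrow> card P' \<le> card P"
  obtains L B b m where "L \<lhd> G" "b \<noteq> p" "card L = b ^ m * p ^ a"
    "B \<subseteq> L" "card B = b ^ m" "B \<noteq> {\<one>}" "elementary_abelian b B"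
proof -
  interpret P: normal P G by (rule P(1))
  interpret Q: group "G Mod P" by (rule P.factorgroup_is_group)
  have cQ: "carrier (G Mod P) = (\<lambda>x. P #> x) ` carrier G" by (rule carrier_FactGroup)
  interpret Q: finite_group "G Mod P"
    by unfold_locales (simp add: cQ fin)
  interpret h: group_hom G "G Mod P" "\<lambda>x. P #> x"
    by unfold_locales (rule P.r_coset_hom_Mod)
  have "solvable (G Mod P)" using h.surj_hom_imp_solvable cQ solv by simp
  moreover have "carrier (G Mod P) \<noteq> {\<one>\<^bsub>G Mod P\<^esub>}"
  proof
    assume "carrier (G Mod P) = {\<one>\<^bsub>G Mod P\<^esub>}"
    then have "P #> x = P" if "x \<in> carrier G" for x using that cQ by auto
    then have "carrier G \<subseteq> P" using rcos_self[OF _ P.is_subgroup] by blast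
    then show False using P(3) P.subset by blast
  qed
  ultimately obtain A b where A: "A \<lhd> G Mod P" "A \<noteq> {\<one>\<^bsub>G Mod P\<^esub>}" "Q.elementary_abelian b A"
    using Q.solvable_elementary_abelian_normal by blast
  note b = Q.elementary_abelianD(1)[OF A(3)] and A_comm = Q.elementary_abelianD(3)[OF A(3)]
    and A_exp = Q.elementary_abelianD(4)[OF A(3)]
  have AQ: "subgroup A (G Mod P)" using A(1) by (rule normal_imp_subgroup)
  obtain m where m: "card A = b ^ m" using Q.card_elementary_abelian[OF A(3)] by blast
  define L where "L = \<Union>A"
  have L: "L \<lhd> G" unfolding L_def by (rule P.factgroup_subgroup_union_normal[OF A(1)])
  have LG: "subgroup L G" using L by (rule normal_imp_subgroup)
  have mem_L: "x \<in> L \<longleftrightarrow> x \<in> carrier G \<and> P #> x \<in> A" for x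
    unfolding L_def using P.factgroup_subgroup_union_char[OF AQ] by auto
  interpret L: group "G\<lparr>carrier := L\<rparr>" by (rule subgroup_imp_group[OF LG])
  have one_A: "P \<in> A" using subgroup.one_closed[OF AQ] by simp
  have "P \<subseteq> L"
    using one_A unfolding L_def by blast
  then have PL: "subgroup P (G\<lparr>carrier := L\<rparr>)" using subgroup_incl[OF P.is_subgroup LG] by blast
  have card_L: "card L = b ^ m * p ^ a"
    using L.lagrange[OF PL] P.factgroup_subgroup_union_factor[OF AQ] m P(2) by (simp add: order_def L_def)
  have "m \<noteq> 0"
  proof
    assume "m = 0"
    then have "card A = 1" using m by simp
    then show False using A(2) one_A by (auto simp: card_1_singleton_iff)
  qed
  then have bm: "b ^ m > 1" using prime_gt_1_nat[OF b] by (intro one_less_power) auto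
  have "b \<noteq> p"
  proof
    assume "b = p"
    then have "card L = p ^ (m + a)" using card_L by (simp add: power_add)
    then have "card L \<le> card P" using max[OF L] by blast
    then have "b ^ m * p ^ a \<le> 1 * p ^ a" using card_L P(2) by simp
    then have "b ^ m \<le> 1" using p prime_gt_0_nat by (metis mult_le_cancel2 zero_less_power)
    then show False using bm by simp
  qed
  have "finite L" using subgroup.subset[OF LG] fin finite_subset by blast
  then obtain B where B: "subgroup B (G\<lparr>carrier := L\<rparr>)" "card B = b ^ m"
    using sylow_thm[OF b L.is_group, of m "p ^ a"] card_L by (auto simp: order_def)
  have BG: "subgroup B G" using incl_subgroup[OF LG B(1)] .
  have BL: "B \<subseteq> L" using subgroup.subset[OF B(1)] by simp
  have Bc: "x \<in> carrier G" if "x \<in> B" for x using that BG subgroup.mem_carrier by metis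
  have PB: "x = \<one>" if "x \<in> P" "x \<in> B" for x
  proof -
    have "ord x dvd p ^ a" "ord x dvd b ^ m"
      using ord_dvd_card_subgroup[OF P.is_subgroup] ord_dvd_card_subgroup[OF BG] that P(2) B(2) by metis+
    moreover have "coprime (p ^ a) (b ^ m)" using p b \<open>b \<noteq> p\<close> by (simp add: primes_coprime)
    ultimately have "ord x = 1" using coprime_common_divisor by (metis nat_dvd_1_iff_1)
    then show ?thesis using ord_eq_1 Bc that by blast
  qed
  have "x \<otimes> y = y \<otimes> x" if xy: "x \<in> B" "y \<in> B" for x y
  proof -
    have xc: "x \<in> carrier G" "y \<in> carrier G" using xy Bc by auto
    have xA: "P #> x \<in> A" "P #> y \<in> A" using xy BL mem_L by blast+
    have "P #> (x \<otimes> y) = (P #> x) <#> (P #> y)" by (rule P.rcos_sum[OF xc, symmetric])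
    also have "\<dots> = (P #> y) <#> (P #> x)" using A_comm[OF xA] unfolding mult_FactGroup .
    also have "\<dots> = P #> (y \<otimes> x)" by (rule P.rcos_sum[OF xc(2,1)])
    finally have "P #> (x \<otimes> y) = P #> (y \<otimes> x)" .
    then have "x \<otimes> y \<in> P #> (y \<otimes> x)" using rcos_self[OF _ P.is_subgroup, of "x \<otimes> y"] xc by simp
    then have "(x \<otimes> y) \<otimes> inv (y \<otimes> x) \<in> P" 
      using P.rcos_module_imp[OF group_axioms, of "y \<otimes> x" "x \<otimes> y"] xc by simp
    moreover have "(x \<otimes> y) \<otimes> inv (y \<otimes> x) \<in> B"
      using xy subgroup.m_closed[OF BG] subgroup.m_inv_closed[OF BG] by blast
    ultimately have "(x \<otimes> y) \<otimes> inv (y \<otimes> x) = \<one>" using PB by blast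
    then show ?thesis using xc by (metis inv_closed inv_equality inv_inv m_closed)
  qed
  moreover have "x [^] b = \<one>" if x: "x \<in> B" for x
  proof (rule PB)
    have "P #> x \<in> A" using x BL mem_L by blast
    then have "P #> (x [^] b) = P" using A_exp[of "P #> x"] P.FactGroup_pow[OF Bc[OF x]] by simp
    then show "x [^] b \<in> P" using rcos_self[OF _ P.is_subgroup, of "x [^] b"] Bc[OF x] by simp
    show "x [^] b \<in> B" for b :: nat
      using x by (induction b) (simp_all add: subgroup.one_closed[OF BG] subgroup.m_closed[OF BG])
  qed
  ultimately have "elementary_abelian b B" using b BG unfolding elementary_abelian_def by blast
  moreover have "B \<noteq> {\<one>}" using B(2) bm by auto
  ultimately show ?thesis using that[OF L \<open>b \<noteq> p\<close> card_L BL B(2)] by blast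
qed

end

section \<open>Claw-free solvable groups\<close>

theorem theorem1p3:
  fixes G :: "('a, 'b) monoid_scheme"
  assumes "group G"
    and "finite (carrier G)"
    and "solvable G"
    and "claw_free (reduced_power_graph G)"
  shows "num_prime_divisors G \<le> 4"
proof (rule ccontr)
  assume "\<not> ?thesis"
  then have five: "card (prime_factors (order G)) \<ge> 5" by (simp add: num_prime_divisors_def)
  interpret claw_free_group G
    using assms by (simp add: claw_free_group_def claw_free_group_axioms_def finite_group_def finite_group_axioms_def)
  have "order G \<noteq> 1" using five by auto
  then have "carrier G \<noteq> {\<one>\<^bsub>G\<^esub>}" by (auto simp: order_def)
  then obtain N p where N: "N \<lhd> G" "N \<noteq> {\<one>\<^bsub>G\<^esub>}" "elementary_abelian p N"
    using solvable_elementary_abelian_normal[OF assms(3)] by blast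
  note p = elementary_abelianD(1)[OF N(3)]
  \<comment> \<open>A largest normal \<open>p\<close>-subgroup; the trivial subgroup shows that there is one.\<close>
  define S where "S = {P. P \<lhd> G \<and> (\<exists>i. card P = p ^ i)}"
  have "S \<subseteq> Pow (carrier G)" unfolding S_def using normal_imp_subgroup subgroup.subset by blast
  then have "finite S" using fin finite_subset by blast
  moreover have "{\<one>\<^bsub>G\<^esub>} \<in> S" unfolding S_def using one_is_normal by (auto intro: exI[of _ 0])
  ultimately have "Max (card ` S) \<in> card ` S" by (intro Max_in) auto
  then obtain P where P: "P \<in> S" "card P = Max (card ` S)" by auto
  then have max: "card P' \<le> card P" if "P' \<in> S" for P' using \<open>finite S\<close> that by simp
  obtain a where a: "P \<lhd> G" "card P = p ^ a" using P(1) unfolding S_def by blast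
  have proper: "P \<noteq> carrier G"
  proof
    assume "P = carrier G"
    then have "prime_factors (order G) \<subseteq> {p}"
      using a p by (cases "a = 0") (auto simp: order_def prime_factorization_prime_power)
    then have "card (prime_factors (order G)) \<le> card {p}" by (intro card_mono) simp_all
    then show False using five by simp
  qed
  have largest: "card P' \<le> card P" if "P' \<lhd> G" "card P' = p ^ i" for P' i
    using max[of P'] that unfolding S_def by blast
  obtain L B b m where L: "L \<lhd> G" "b \<noteq> p" "card L = b ^ m * p ^ a"
    and B: "B \<subseteq> L" "card B = b ^ m" "B \<noteq> {\<one>\<^bsub>G\<^esub>}" "elementary_abelian b B"
    by (rule elementary_abelian_layer[OF assms(3) p a proper largest]) blast
  interpret claw_free_tower G N p B b
    by (intro claw_free_tower.intro elementary_abelian_normal.intro elementary_abelian_normal_axioms.intro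
      claw_free_tower_axioms.intro claw_free_group_axioms finite_group_axioms N L B)
  have "\<exists>y. normalizes y \<and> ord y = r" if r: "r \<in> prime_factors (order G) - {p, b}" for r
  proof -
    have rp: "prime r" "r dvd order G" using r by (auto simp: in_prime_factors_iff)
    obtain x where x: "x \<in> carrier G" "ord x = r" using cauchy rp by blast
    have not_dvd: "\<not> q dvd q' ^ i" if "prime q" "prime q'" "q \<noteq> q'" for q q' i :: nat
      using that prime_dvd_power[of q q' i] primes_dvd_imp_eq[of q q'] by blast
    have nb: "\<not> b dvd p ^ a" using not_dvd[OF b(1) p b(2)] .
    obtain l where l: "l \<in> L" "\<forall>y\<in>B. conjby (inv\<^bsub>G\<^esub> l \<otimes>\<^bsub>G\<^esub> x) y \<in> B"
      using frattini[OF L(1) B_subgroup B(1,2) L(3) b(1) nb x(1)] by blast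
    have lc: "l \<in> carrier G" using l L(1) normal_imp_subgroup subgroup.mem_carrier by metis
    let ?h = "inv\<^bsub>G\<^esub> l \<otimes>\<^bsub>G\<^esub> x"
    have h: "normalizes ?h" unfolding normalizes_def using l lc x by simp
    have "\<not> r dvd card L"
      using not_dvd[OF rp(1) b(1)] not_dvd[OF rp(1) p] r rp(1) by (simp add: L(3) prime_dvd_mult_iff)
    then have "r dvd ord ?h" using coprime_order_transfer[OF L(1) x(1) _ _ l(1)] x rp by simp
    then obtain k where k: "ord ?h = r * k" by blast
    then have "k \<noteq> 0" using ord_pos[OF normalizes_carrier[OF h]] by auto
    then have "ord (?h [^]\<^bsub>G\<^esub> k) = r" using ord_pow[OF normalizes_carrier[OF h], of k] k by simp
    then show ?thesis using normalizes_pow[OF h] by blast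
  qed
  then have "\<forall>r\<in>prime_factors (order G) - {p, b}. \<exists>y. normalizes y \<and> ord y = r" by blast
  from bchoice[OF this] obtain y
    where y: "\<And>r. r \<in> prime_factors (order G) - {p, b} \<Longrightarrow> normalizes (y r) \<and> ord (y r) = r" by blast
  have "card (prime_factors (order G) - {p, b}) \<ge> 3"
    using five diff_card_le_card_Diff[of "{p, b}" "prime_factors (order G)"] b_neq_p by simp
  then obtain R where R: "R \<subseteq> prime_factors (order G) - {p, b}" "card R = 3"
    by (rule obtain_subset_with_card_n)
  then obtain f where f: "bij_betw f {1, 2, 3::nat} R"
    using finite_same_card_bij[of "{1, 2, 3::nat}" R] finite_subset[OF R(1)] by auto
  have fR: "f i \<in> prime_factors (order G) - {p, b}" if "i \<in> {1, 2, 3}" for i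
    using bij_betwE[OF f] R(1) that by blast
  show False
  proof (rule no_three_normalizing_primes[of "\<lambda>i. y (f i)"])
    show "normalizes (y (f i)) \<and> prime (ord (y (f i))) \<and> ord (y (f i)) \<noteq> p \<and> ord (y (f i)) \<noteq> b"
      if "i \<in> {1, 2, 3}" for i
      using y[OF fR[OF that]] fR[OF that] by (auto simp: in_prime_factors_iff)
    show "inj_on (\<lambda>i. ord (y (f i))) {1, 2, 3}"
    proof (rule inj_onI)
      fix i j :: nat
      assume ij: "i \<in> {1, 2, 3}" "j \<in> {1, 2, 3}" "ord (y (f i)) = ord (y (f j))"
      then have "f i = f j" using y[OF fR[OF ij(1)]] y[OF fR[OF ij(2)]] by simp
      then show "i = j" using inj_onD[OF bij_betw_imp_inj_on[OF f]] ij(1,2) by blast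
    qed
  qed
qed

end
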